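(* The following classes of algebras of type $\langle 2,2,1\rangle$ coincide: (1) $\mathcal{RBDMBL}$; (2) $R(Bip(\mathcal{DML}))$; (3) $V(\mathbf{DM}_4,\mathbf{IS}_2,\mathbf{IS}_3)$; (4) the class of (isomorphic images of) De Morgan–Płonka sums of distributive lattices over involutive semilattices belonging to $V(\mathbf{IS}_2,\mathbf{IS}_3)$.
   Context: A De Morgan bisemilattice is an algebra $\langle B,\land,\lor,\lnot\rangle$ such that $\langle B,\land\rangle$, $\langle B,\lor\rangle$ are semilattices, each of $\land,\lor$ distributes over the other, and $\lnot\lnot x\approx x$, $\lnot(x\land y)\approx\lnot x\lor\lnot y$, $\lnot(x\lor y)\approx\lnot x\land\lnot y$ hold; $\mathcal{DMBL}$ is their variety. $\mathcal{RBDMBL}$ is the subvariety of $\mathcal{DMBL}$ axiomatised by $x\land(x\lor\lnot x)\land(x\lor\lnot x\lor y)\approx x\land(x\lor\lnot x)\land(x\lor\lnot x\lor\lnot y)$. $\mathcal{DML}$ is the variety of De Morgan lattices. $\mathbf{DM}_4$ is the De Morgan lattice $\{\mathbf{t},\mathbf{f},\top,\bot\}$ with lattice order $\mathbf{f}<\top,\bot<\mathbf{t}$, $\lnot\mathbf{t}=\mathbf{f}$, $\lnot\top=\top$, $\lnot\bot=\bot$. An involutive semilattice $\langle I,\lor,\lnot\rangle$ is a semilattice with $\lnot\lnot x\approx x$, $\lnot(x\lor y)\approx\lnot x\lor\lnot y$, viewed as type $\langle 2,2,1\rangle$ with $x\land y:=x\lor y$. $\mathbf{IS}_2$ is $\{\mathbf{i}<\mathbf{j}\}$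 with $\lnot$ the identity; $\mathbf{IS}_3$ is $\{\mathbf{i},\lnot\mathbf{i},\mathbf{j}\}$ with $\mathbf{i}\ne\lnot\mathbf{i}$, $\lnot\mathbf{j}=\mathbf{j}$ top, $\mathbf{i}\lor\lnot\mathbf{i}=\mathbf{j}$. $V(\mathcal{K})$ is the variety generated by $\mathcal{K}$. For a term $\varphi$, $Var(\varphi)$ is its set of variables and $Var^{+}(\varphi)$ (resp. $Var^{-}(\varphi)$) the set of variables with an occurrence in the scope of an even (resp. odd) number of $\lnot$'s. An identity $\varphi\approx\psi$ is regular if $Var(\varphi)=Var(\psi)$; balanced regular if $Var^\pm(\varphi)=Var^\pm(\psi)$; bipolar if $Var^+(\varphi)\cap Var^-(\varphi)\ne\emptyset$ and $Var^+(\psi)\cap Var^-(\psi)\ne\emptyset$; regular bipolarly balanced if it is either bipolar and regular, or balanced regular. For a variety $\mathcal{V}$, $R(Bip(\mathcal{V}))$ is the variety satisfying all and only the regular bipolarly balanced identities valid in $\mathcal{V}$. An involutive semilattice direct system of distributive lattices consists of an involutive semilattice $\mathbf{I}$ (order $\le$), distributive lattices $F(i)$ with pairwise disjoint universes, lattice homomorphisms $p_{ij}:F(i)\to F(j)$ for $i\le j$ with $p_{ii}=\mathrm{id}$, $p_{jk}\circ p_{ij}=p_{ik}$, and bijections $n_i:F(i)\to F(\lnot i)$ that interchange $\land$ and $\lor$, with $n_{\lnot i}=n_i^{-1}$ and $n_j\circ p_{ij}=p_{\lnot i,\lnot j}\circ n_i$. Its De Morgan–Płonka sum has universe $\bigsqcup_i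 F(i)$, $a\land b=p_{ik}(a)\land^{F(k)}p_{jk}(b)$, $a\lor b=p_{ik}(a)\lor^{F(k)}p_{jk}(b)$ for $a\in F(i),b\in F(j)$, $k=i\lor j$, and $\lnot a=n_i(a)$ for $a\in F(i)$; $\mathbf{I}$ is its underlying involutive semilattice. *)

theory Defs
  imports Main "HOL-Library.Countable_Set"
begin

section \<open>Terms and algebras of type (2,2,1)\<close>

datatype (vars: 'v) trm =
    Var 'v
  | Conj "'v trm" "'v trm"  (infixl "\<^bold>\<and>" 75)
  | Disj "'v trm" "'v trm"  (infixl "\<^bold>\<or>" 75)
  | Neg "'v trm"  ("\<^bold>\<not>_" [80] 80)

type_synonym identity = "nat trm \<times> nat trm"

abbreviation equ :: "'v trm \<Rightarrow> 'v trm \<Rightarrow> 'v trm \<times> 'v trm"  (infix "\<doteq>" 60)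
  where "s \<doteq> t \<equiv> (s, t)"

text \<open>Only the behaviour of the operations on the carrier matters.  Lattices are the reducts
  without negation.\<close>

record 'a lat =
  carrier :: "'a set"
  meet :: "'a \<Rightarrow> 'a \<Rightarrow> 'a"
  join :: "'a \<Rightarrow> 'a \<Rightarrow> 'a"

record 'a alg = "'a lat" +
  neg :: "'a \<Rightarrow> 'a"

definition lat_closed :: "('a, 'm) lat_scheme \<Rightarrow> bool" where
  "lat_closed L \<longleftrightarrow> carrier L \<noteq> {} \<and>
     (\<forall>a\<in>carrier L. \<forall>b\<in>carrier L. meet L a b \<in> carrier L \<and> join L a b \<in> carrier L)"

definition algebra :: "'a alg \<Rightarrow> bool" where
  "algebra A \<longleftrightarrow> lat_closed A \<and> (\<forall>a\<in>carrier A. neg A a \<in> carrier A)"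

definition lat_hom :: "('a \<Rightarrow> 'b) \<Rightarrow> ('a, 'm) lat_scheme \<Rightarrow> ('b, 'n) lat_scheme \<Rightarrow> bool" where
  "lat_hom h L M \<longleftrightarrow> h ` carrier L \<subseteq> carrier M \<and>
     (\<forall>a\<in>carrier L. \<forall>b\<in>carrier L.
        h (meet L a b) = meet M (h a) (h b) \<and> h (join L a b) = join M (h a) (h b))"

definition alg_hom :: "('a \<Rightarrow> 'b) \<Rightarrow> 'a alg \<Rightarrow> 'b alg \<Rightarrow> bool" where
  "alg_hom h A B \<longleftrightarrow> lat_hom h A B \<and> (\<forall>a\<in>carrier A. h (neg A a) = neg B (h a))"

definition isomorphic :: "'a alg \<Rightarrow> 'b alg \<Rightarrow> bool"  (infix "\<cong>" 50) where
  "A \<cong> B \<longleftrightarrow> (\<exists>h. alg_hom h A B \<and> bij_betw h (carrier A) (carrier B))"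

primrec eval :: "'a alg \<Rightarrow> ('v \<Rightarrow> 'a) \<Rightarrow> 'v trm \<Rightarrow> 'a" where
  "eval A v (Var x) = v x"
| "eval A v (s \<^bold>\<and> t) = meet A (eval A v s) (eval A v t)"
| "eval A v (s \<^bold>\<or> t) = join A (eval A v s) (eval A v t)"
| "eval A v (\<^bold>\<not>s) = neg A (eval A v s)"

definition satisfies :: "'a alg \<Rightarrow> identity \<Rightarrow> bool"  (infix "\<Turnstile>" 50) where
  "A \<Turnstile> e \<longleftrightarrow> (\<forall>v. range v \<subseteq> carrier A \<longrightarrow> eval A v (fst e) = eval A v (snd e))"


section \<open>Varieties\<close>

definition Mod :: "identity set \<Rightarrow> 'a alg set" where
  "Mod \<Sigma> = {A. algebra A \<and> (\<forall>e\<in>\<Sigma>. A \<Turnstile> e)}"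

definition Idt :: "'a alg set \<Rightarrow> identity set" where
  "Idt K = {e. \<forall>A\<in>K. A \<Turnstile> e}"

text \<open>A variety is an equational class, and the variety generated by a class is the least
  equational class including it; the algebras of \<open>K\<close> and those of the variety may live
  on different types. That this is the closure under homomorphic images, subalgebras and products
  is \<open>generated_variety_HSP\<close> below.\<close>

definition generated_variety :: "'k alg set \<Rightarrow> 'a alg set" where
  "generated_variety K = \<Inter> {Mod \<Sigma> |\<Sigma>. K \<subseteq> Mod \<Sigma>}"

abbreviation (input) var_x ("\<^bold>x") where "\<^bold>x \<equiv> Var (0::nat)"
abbreviation (input) var_y ("\<^bold>y") where "\<^bold>y \<equiv> Var (1::nat)"
abbreviation (input) var_z ("\<^bold>z") where "\<^bold>z \<equiv> Var (2::nat)"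

definition dmbl_axioms :: "identity set" where
  "dmbl_axioms =
    {\<^bold>x \<^bold>\<and> \<^bold>x \<doteq> \<^bold>x, \<^bold>x \<^bold>\<and> \<^bold>y \<doteq> \<^bold>y \<^bold>\<and> \<^bold>x, (\<^bold>x \<^bold>\<and> \<^bold>y) \<^bold>\<and> \<^bold>z \<doteq> \<^bold>x \<^bold>\<and> (\<^bold>y \<^bold>\<and> \<^bold>z),
     \<^bold>x \<^bold>\<or> \<^bold>x \<doteq> \<^bold>x, \<^bold>x \<^bold>\<or> \<^bold>y \<doteq> \<^bold>y \<^bold>\<or> \<^bold>x, (\<^bold>x \<^bold>\<or> \<^bold>y) \<^bold>\<or> \<^bold>z \<doteq> \<^bold>x \<^bold>\<or> (\<^bold>y \<^bold>\<or> \<^bold>z),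
     \<^bold>x \<^bold>\<and> (\<^bold>y \<^bold>\<or> \<^bold>z) \<doteq> (\<^bold>x \<^bold>\<and> \<^bold>y) \<^bold>\<or> (\<^bold>x \<^bold>\<and> \<^bold>z),
     \<^bold>x \<^bold>\<or> (\<^bold>y \<^bold>\<and> \<^bold>z) \<doteq> (\<^bold>x \<^bold>\<or> \<^bold>y) \<^bold>\<and> (\<^bold>x \<^bold>\<or> \<^bold>z),
     \<^bold>\<not>(\<^bold>\<not>\<^bold>x) \<doteq> \<^bold>x,
     \<^bold>\<not>(\<^bold>x \<^bold>\<and> \<^bold>y) \<doteq> \<^bold>\<not>\<^bold>x \<^bold>\<or> \<^bold>\<not>\<^bold>y,
     \<^bold>\<not>(\<^bold>x \<^bold>\<or> \<^bold>y) \<doteq> \<^bold>\<not>\<^bold>x \<^bold>\<and> \<^bold>\<not>\<^bold>y}"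

definition DMBL :: "'a alg set" where
  "DMBL = Mod dmbl_axioms"

definition RBDMBL :: "'a alg set" where
  "RBDMBL = DMBL \<inter> Mod {\<^bold>x \<^bold>\<and> (\<^bold>x \<^bold>\<or> \<^bold>\<not>\<^bold>x) \<^bold>\<and> (\<^bold>x \<^bold>\<or> \<^bold>\<not>\<^bold>x \<^bold>\<or> \<^bold>y) \<doteq> \<^bold>x \<^bold>\<and> (\<^bold>x \<^bold>\<or> \<^bold>\<not>\<^bold>x) \<^bold>\<and> (\<^bold>x \<^bold>\<or> \<^bold>\<not>\<^bold>x \<^bold>\<or> \<^bold>\<not>\<^bold>y)}"

definition DML :: "'a alg set" where
  "DML = Mod (dmbl_axioms \<union> {\<^bold>x \<^bold>\<and> (\<^bold>x \<^bold>\<or> \<^bold>y) \<doteq> \<^bold>x, \<^bold>x \<^bold>\<or> (\<^bold>x \<^bold>\<and> \<^bold>y) \<doteq> \<^bold>x})"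

definition InvSL :: "'a alg set" where
  "InvSL = Mod
    {\<^bold>x \<^bold>\<or> \<^bold>x \<doteq> \<^bold>x, \<^bold>x \<^bold>\<or> \<^bold>y \<doteq> \<^bold>y \<^bold>\<or> \<^bold>x, (\<^bold>x \<^bold>\<or> \<^bold>y) \<^bold>\<or> \<^bold>z \<doteq> \<^bold>x \<^bold>\<or> (\<^bold>y \<^bold>\<or> \<^bold>z),
     \<^bold>\<not>(\<^bold>\<not>\<^bold>x) \<doteq> \<^bold>x, \<^bold>\<not>(\<^bold>x \<^bold>\<or> \<^bold>y) \<doteq> \<^bold>\<not>\<^bold>x \<^bold>\<or> \<^bold>\<not>\<^bold>y,
     \<^bold>x \<^bold>\<and> \<^bold>y \<doteq> \<^bold>x \<^bold>\<or> \<^bold>y}"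


section \<open>The algebras \<open>DM4\<close>, \<open>IS2\<close>, \<open>IS3\<close>\<close>

text \<open>A single carrier type, so that the three algebras can be collected in one set.\<close>

datatype elt = TT | FF | Top | Bot | EI | ENI | EJ

fun dm4_join :: "elt \<Rightarrow> elt \<Rightarrow> elt" where
  "dm4_join a b = (if a = b then a else if a = FF then b else if b = FF then a else TT)"

fun dm4_meet :: "elt \<Rightarrow> elt \<Rightarrow> elt" where
  "dm4_meet a b = (if a = b then a else if a = TT then b else if b = TT then a else FF)"

definition DM4 :: "elt alg" where
  "DM4 = \<lparr>carrier = {TT, FF, Top, Bot}, meet = dm4_meet, join = dm4_join,
          neg = (\<lambda>a. if a = TT then FF else if a = FF then TT else a)\<rparr>"

fun is_join :: "elt \<Rightarrow> elt \<Rightarrow> elt" where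
  "is_join a b = (if a = b then a else EJ)"

definition IS2 :: "elt alg" where
  "IS2 = \<lparr>carrier = {EI, EJ}, meet = is_join, join = is_join, neg = (\<lambda>a. a)\<rparr>"

definition IS3 :: "elt alg" where
  "IS3 = \<lparr>carrier = {EI, ENI, EJ}, meet = is_join, join = is_join,
          neg = (\<lambda>a. if a = EI then ENI else if a = ENI then EI else a)\<rparr>"


section \<open>Regular bipolarly balanced identities\<close>

text \<open>\<open>occ True t\<close> and \<open>occ False t\<close> are the sets of variables occurring in \<open>t\<close> in the scope of an
  even, respectively odd, number of negations.\<close>

primrec occ :: "bool \<Rightarrow> 'v trm \<Rightarrow> 'v set" where
  "occ p (Var u) = (if p then {u} else {})"
| "occ p (s \<^bold>\<and> t) = occ p s \<union> occ p t"
| "occ p (s \<^bold>\<or> t) = occ p s \<union> occ p t"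
| "occ p (\<^bold>\<not>s) = occ (\<not> p) s"

abbreviation Var_pos :: "'v trm \<Rightarrow> 'v set" where "Var_pos \<equiv> occ True"
abbreviation Var_neg :: "'v trm \<Rightarrow> 'v set" where "Var_neg \<equiv> occ False"

definition regular :: "identity \<Rightarrow> bool" where
  "regular e \<longleftrightarrow> vars (fst e) = vars (snd e)"

definition balanced_regular :: "identity \<Rightarrow> bool" where
  "balanced_regular e \<longleftrightarrow> Var_pos (fst e) = Var_pos (snd e) \<and> Var_neg (fst e) = Var_neg (snd e)"

definition bipolar :: "identity \<Rightarrow> bool" where
  "bipolar e \<longleftrightarrow> Var_pos (fst e) \<inter> Var_neg (fst e) \<noteq> {} \<and> Var_pos (snd e) \<inter> Var_neg (snd e) \<noteq> {}"

definition regular_bipolarly_balanced :: "identity \<Rightarrow> bool" where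
  "regular_bipolarly_balanced e \<longleftrightarrow> bipolar e \<and> regular e \<or> balanced_regular e"

text \<open>A variety satisfying all and only the identities in \<open>\<Theta>\<close> is necessarily \<open>Mod \<Theta>\<close>. That these
  models satisfy no further identities is \<open>Idt_RBip\<close> below. The parameter \<open>V\<close> only contributes its
  identities; for a variety, its members on \<open>nat\<close> determine these: see \<open>Idt_Mod_nat\<close>.\<close>

definition RBip :: "'b alg set \<Rightarrow> 'a alg set" where
  "RBip V = Mod {e \<in> Idt V. regular_bipolarly_balanced e}"


section \<open>De Morgan-Plonka sums\<close>

definition distributive_lattice :: "'a lat \<Rightarrow> bool" where
  "distributive_lattice L \<longleftrightarrow> lat_closed L \<and>
    (\<forall>a\<in>carrier L. \<forall>b\<in>carrier L. \<forall>c\<in>carrier L.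
       meet L a b = meet L b a \<and> join L a b = join L b a \<and>
       meet L (meet L a b) c = meet L a (meet L b c) \<and>
       join L (join L a b) c = join L a (join L b c) \<and>
       meet L a (join L a b) = a \<and> join L a (meet L a b) = a \<and>
       meet L a (join L b c) = join L (meet L a b) (meet L a c))"

definition isl_le :: "'i alg \<Rightarrow> 'i \<Rightarrow> 'i \<Rightarrow> bool" where
  "isl_le S i j \<longleftrightarrow> i \<in> carrier S \<and> j \<in> carrier S \<and> join S i j = j"

locale dm_system =
  fixes S :: "'i alg"
    and F :: "'i \<Rightarrow> 'a lat"
    and p :: "'i \<Rightarrow> 'i \<Rightarrow> 'a \<Rightarrow> 'a"
    and n :: "'i \<Rightarrow> 'a \<Rightarrow> 'a"
  assumes index: "S \<in> InvSL"
    and fibre: "i \<in> carrier S \<Longrightarrow> distributive_lattice (F i)"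
    and disjoint: "\<lbrakk>i \<in> carrier S; j \<in> carrier S; i \<noteq> j\<rbrakk> \<Longrightarrow> carrier (F i) \<inter> carrier (F j) = {}"
    and trans_hom: "isl_le S i j \<Longrightarrow> lat_hom (p i j) (F i) (F j)"
    and trans_id: "\<lbrakk>i \<in> carrier S; a \<in> carrier (F i)\<rbrakk> \<Longrightarrow> p i i a = a"
    and trans_comp: "\<lbrakk>isl_le S i j; isl_le S j k; a \<in> carrier (F i)\<rbrakk> \<Longrightarrow> p j k (p i j a) = p i k a"
    and neg_bij: "i \<in> carrier S \<Longrightarrow> bij_betw (n i) (carrier (F i)) (carrier (F (neg S i)))"
    and neg_meet: "\<lbrakk>i \<in> carrier S; a \<in> carrier (F i); b \<in> carrier (F i)\<rbrakk> \<Longrightarrow>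
          n i (meet (F i) a b) = join (F (neg S i)) (n i a) (n i b)"
    and neg_join: "\<lbrakk>i \<in> carrier S; a \<in> carrier (F i); b \<in> carrier (F i)\<rbrakk> \<Longrightarrow>
          n i (join (F i) a b) = meet (F (neg S i)) (n i a) (n i b)"
    and neg_inverse: "\<lbrakk>i \<in> carrier S; a \<in> carrier (F i)\<rbrakk> \<Longrightarrow> n (neg S i) (n i a) = a"
    and neg_trans: "\<lbrakk>isl_le S i j; a \<in> carrier (F i)\<rbrakk> \<Longrightarrow>
          n j (p i j a) = p (neg S i) (neg S j) (n i a)"

definition fibre_of :: "'i alg \<Rightarrow> ('i \<Rightarrow> 'a lat) \<Rightarrow> 'a \<Rightarrow> 'i" where
  "fibre_of S F a = (THE i. i \<in> carrier S \<and> a \<in> carrier (F i))"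

definition dmp_sum ::
    "'i alg \<Rightarrow> ('i \<Rightarrow> 'a lat) \<Rightarrow> ('i \<Rightarrow> 'i \<Rightarrow> 'a \<Rightarrow> 'a) \<Rightarrow> ('i \<Rightarrow> 'a \<Rightarrow> 'a) \<Rightarrow> 'a alg" where
  "dmp_sum S F p n =
    \<lparr>carrier = (\<Union>i\<in>carrier S. carrier (F i)),
     meet = (\<lambda>a b. let i = fibre_of S F a; j = fibre_of S F b; k = join S i j
                   in meet (F k) (p i k a) (p j k b)),
     join = (\<lambda>a b. let i = fibre_of S F a; j = fibre_of S F b; k = join S i j
                   in join (F k) (p i k a) (p j k b)),
     neg = (\<lambda>a. n (fibre_of S F a) a)\<rparr>"

text \<open>Isomorphic images of sums of systems indexed by members of \<open>K\<close>. Taking the indices and the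
  elements of the summands in the type of the sum itself is no restriction:
  see \<open>dmp_sumsI\<close> below.\<close>

definition dmp_sums :: "'a alg set \<Rightarrow> 'a alg set" where
  "dmp_sums K = {A. algebra A \<and>
     (\<exists>(S :: 'a alg) (F :: 'a \<Rightarrow> 'a lat) p n. S \<in> K \<and> dm_system S F p n \<and> A \<cong> dmp_sum S F p n)}"

section \<open>Adequacy of the definitions\<close>

subsection \<open>Homomorphisms and identities\<close>

lemma alg_closed:
  assumes "algebra A"
  shows "carrier A \<noteq> {}"
    and "a \<in> carrier A \<Longrightarrow> b \<in> carrier A \<Longrightarrow> meet A a b \<in> carrier A"
    and "a \<in> carrier A \<Longrightarrow> b \<in> carrier A \<Longrightarrow> join A a b \<in> carrier A"
    and "a \<in> carrier A \<Longrightarrow> neg A a \<in> carrier A"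
  using assms by (auto simp: algebra_def lat_closed_def)

lemma eval_closed: "\<lbrakk>algebra A; range v \<subseteq> carrier A\<rbrakk> \<Longrightarrow> eval A v t \<in> carrier A"
  by (induction t) (auto intro: alg_closed)

lemma alg_homD:
  assumes "alg_hom h A B"
  shows "a \<in> carrier A \<Longrightarrow> h a \<in> carrier B"
    and "a \<in> carrier A \<Longrightarrow> b \<in> carrier A \<Longrightarrow> h (meet A a b) = meet B (h a) (h b)"
    and "a \<in> carrier A \<Longrightarrow> b \<in> carrier A \<Longrightarrow> h (join A a b) = join B (h a) (h b)"
    and "a \<in> carrier A \<Longrightarrow> h (neg A a) = neg B (h a)"
  using assms by (auto simp: alg_hom_def lat_hom_def)

lemma alg_homI:
  assumes "\<And>a. a \<in> carrier A \<Longrightarrow> h a \<in> carrier B"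
    and "\<And>a b. a \<in> carrier A \<Longrightarrow> b \<in> carrier A \<Longrightarrow> h (meet A a b) = meet B (h a) (h b)"
    and "\<And>a b. a \<in> carrier A \<Longrightarrow> b \<in> carrier A \<Longrightarrow> h (join A a b) = join B (h a) (h b)"
    and "\<And>a. a \<in> carrier A \<Longrightarrow> h (neg A a) = neg B (h a)"
  shows "alg_hom h A B"
  using assms by (auto simp: alg_hom_def lat_hom_def)

lemma hom_eval:
  assumes "algebra A" "alg_hom h A B" "range v \<subseteq> carrier A"
  shows "h (eval A v t) = eval B (\<lambda>u. h (v u)) t"
  using assms by (induction t) (auto simp: alg_homD[OF assms(2)] eval_closed)

lemma satisfies_embedding:
  assumes "algebra A" "alg_hom h A B" "inj_on h (carrier A)" "B \<Turnstile> e"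
  shows "A \<Turnstile> e"
  unfolding satisfies_def
proof (intro allI impI)
  fix v :: "nat \<Rightarrow> 'a" assume v: "range v \<subseteq> carrier A"
  have "range (\<lambda>u. h (v u)) \<subseteq> carrier B" using v alg_homD(1)[OF assms(2)] by auto
  then have "h (eval A v (fst e)) = h (eval A v (snd e))"
    using assms(4) by (simp add: hom_eval[OF assms(1,2) v] satisfies_def)
  then show "eval A v (fst e) = eval A v (snd e)"
    using assms(1,3) v by (meson eval_closed inj_onD)
qed

lemma satisfies_hom_image:
  assumes "algebra A" "alg_hom h A B" "h ` carrier A = carrier B" "A \<Turnstile> e"
  shows "B \<Turnstile> e"
  unfolding satisfies_def
proof (intro allI impI)
  fix w :: "nat \<Rightarrow> 'b" assume w: "range w \<subseteq> carrier B"
  define v where "v u = inv_into (carrier A) h (w u)" for u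
  have v: "range v \<subseteq> carrier A" and hv: "(\<lambda>u. h (v u)) = w"
    using w assms(3) by (auto simp: v_def image_subset_iff inv_into_into f_inv_into_f)
  show "eval B w (fst e) = eval B w (snd e)"
    using hom_eval[OF assms(1,2) v, of "fst e"] hom_eval[OF assms(1,2) v, of "snd e"] assms(4) v hv
    by (simp add: satisfies_def)
qed

definition copy :: "('a \<Rightarrow> 'b) \<Rightarrow> 'a alg \<Rightarrow> 'b alg" where
  "copy f A = (let g = inv_into (carrier A) f in
     \<lparr>carrier = f ` carrier A, meet = (\<lambda>a b. f (meet A (g a) (g b))),
      join = (\<lambda>a b. f (join A (g a) (g b))), neg = (\<lambda>a. f (neg A (g a)))\<rparr>)"

lemma copy:
  assumes "algebra A" "inj_on f (carrier A)"
  shows "algebra (copy f A)" "alg_hom f A (copy f A)"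
    "alg_hom (inv_into (carrier A) f) (copy f A) A"
    "bij_betw f (carrier A) (carrier (copy f A))"
proof -
  have ops: "carrier (copy f A) = f ` carrier A"
    "\<And>a b. meet (copy f A) a b = f (meet A (inv_into (carrier A) f a) (inv_into (carrier A) f b))"
    "\<And>a b. join (copy f A) a b = f (join A (inv_into (carrier A) f a) (inv_into (carrier A) f b))"
    "\<And>a. neg (copy f A) a = f (neg A (inv_into (carrier A) f a))"
    by (simp_all add: copy_def Let_def)
  note inv = inv_into_f_f[OF assms(2)] and c = alg_closed[OF assms(1)]
  show "algebra (copy f A)"
    using c(1) by (simp add: algebra_def lat_closed_def ops inv c)
  show "alg_hom f A (copy f A)"
    by (rule alg_homI) (simp_all add: ops inv)
  show "alg_hom (inv_into (carrier A) f) (copy f A) A"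
    by (rule alg_homI) (auto simp: ops inv c)
  show "bij_betw f (carrier A) (carrier (copy f A))"
    using assms(2) by (simp add: bij_betw_def ops)
qed

lemma generated_variety_eq:
  assumes "\<forall>A\<in>K. algebra A"
  shows "generated_variety K = Mod (Idt K)"
proof
  have "K \<subseteq> Mod (Idt K)" using assms by (auto simp: Mod_def Idt_def)
  then show "generated_variety K \<subseteq> Mod (Idt K)" unfolding generated_variety_def by blast
  have "\<Sigma> \<subseteq> Idt K" if "K \<subseteq> Mod \<Sigma>" for \<Sigma>
    using that by (auto simp: Mod_def Idt_def)
  then show "Mod (Idt K) \<subseteq> generated_variety K"
    unfolding generated_variety_def by (auto simp: Mod_def)
qed

subsection \<open>Identities of a variety are determined by its countable members\<close>

instance trm :: (countable) countable
  by countable_datatype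

lemma Idt_Mod_nat:
  assumes "e \<in> Idt (Mod \<Sigma> :: nat alg set)"
  shows "e \<in> Idt (Mod \<Sigma> :: 'a alg set)"
  unfolding Idt_def
proof (intro CollectI ballI)
  fix A :: "'a alg" assume A: "A \<in> Mod \<Sigma>"
  then have alg: "algebra A" by (simp add: Mod_def)
  show "A \<Turnstile> e"
    unfolding satisfies_def
  proof (intro allI impI)
    fix v :: "nat \<Rightarrow> 'a" assume v: "range v \<subseteq> carrier A"
    define B where "B = A\<lparr>carrier := range (eval A v)\<rparr>"
    have Bops: "meet B = meet A" "join B = join A" "neg B = neg A" "carrier B = range (eval A v)"
      by (simp_all add: B_def)
    have algB: "algebra B"
      unfolding algebra_def lat_closed_def Bops
      by (auto simp flip: eval.simps)
    have BA: "alg_hom id B A"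
      using eval_closed[OF alg v] by (auto intro!: alg_homI simp: Bops)
    have "countable (carrier B)" by (simp add: Bops)
    then obtain f :: "'a \<Rightarrow> nat" where f: "inj_on f (carrier B)" by (auto simp: countable_def)
    let ?C = "copy f B"
    note C = copy[OF algB f]
    have "?C \<Turnstile> d" if "d \<in> \<Sigma>" for d
    proof (rule satisfies_embedding[OF C(1) C(3)])
      show "inj_on (inv_into (carrier B) f) (carrier ?C)"
        using C(4) by (simp add: bij_betw_def inj_on_inv_into)
      show "B \<Turnstile> d"
        using satisfies_embedding[OF algB BA] A that by (auto simp: Mod_def)
    qed
    then have "?C \<in> Mod \<Sigma>" using C(1) by (simp add: Mod_def)
    then have "?C \<Turnstile> e" using assms by (auto simp: Idt_def)
    then have "B \<Turnstile> e" using satisfies_embedding[OF algB C(2) f] by blast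
    moreover have "range v \<subseteq> carrier B"
      by (auto simp: Bops) (metis eval.simps(1) rangeI)
    ultimately have "eval B v (fst e) = eval B v (snd e)" by (simp add: satisfies_def)
    moreover have "eval B v t = eval A v t" for t by (induction t) (auto simp: Bops)
    ultimately show "eval A v (fst e) = eval A v (snd e)" by simp
  qed
qed

subsection \<open>\<open>RBip V\<close> satisfies only regular bipolarly balanced identities of \<open>V\<close>\<close>

primrec tsubst :: "('v \<Rightarrow> 'w trm) \<Rightarrow> 'v trm \<Rightarrow> 'w trm" where
  "tsubst \<sigma> (Var u) = \<sigma> u"
| "tsubst \<sigma> (s \<^bold>\<and> t) = tsubst \<sigma> s \<^bold>\<and> tsubst \<sigma> t"
| "tsubst \<sigma> (s \<^bold>\<or> t) = tsubst \<sigma> s \<^bold>\<or> tsubst \<sigma> t"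
| "tsubst \<sigma> (\<^bold>\<not>s) = \<^bold>\<not>(tsubst \<sigma> s)"

lemma eval_subst: "eval A v (tsubst \<sigma> t) = eval A (\<lambda>u. eval A v (\<sigma> u)) t"
  by (induction t) auto

lemma vars_occ: "vars t = occ p t \<union> occ (\<not> p) t"
  by (induction t arbitrary: p) auto

lemma occ_subst: "occ p (tsubst \<sigma> t) = (\<Union>q. \<Union>u\<in>occ q t. occ (p = q) (\<sigma> u))"
  by (induction t arbitrary: p) (auto simp: UNIV_bool)

lemma rbb_iff: "regular_bipolarly_balanced (s, t) \<longleftrightarrow>
   (\<forall>p. occ p s = occ p t) \<or>
   (vars s = vars t \<and> occ True s \<inter> occ False s \<noteq> {} \<and> occ True t \<inter> occ False t \<noteq> {})"
  unfolding regular_bipolarly_balanced_def bipolar_def regular_def balanced_regular_def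
  by (auto simp: all_bool_eq)

lemma vars_tsubst: "vars (tsubst \<sigma> t) = (\<Union>u\<in>vars t. vars (\<sigma> u))"
  by (induction t) auto

lemma vars_nonempty: "vars t \<noteq> {}"
  by (induction t) auto

lemma bipolar_tsubst:
  assumes "occ True s \<inter> occ False s \<noteq> {}"
  shows "occ True (tsubst \<sigma> s) \<inter> occ False (tsubst \<sigma> s) \<noteq> {}"
proof -
  obtain u where u: "u \<in> occ True s" "u \<in> occ False s" using assms by blast
  obtain w where "w \<in> vars (\<sigma> u)" using vars_nonempty[of "\<sigma> u"] by blast
  then have "w \<in> occ True (\<sigma> u) \<or> w \<in> occ False (\<sigma> u)" by (simp add: vars_occ[of _ True])
  then have "w \<in> occ True (tsubst \<sigma> s) \<and> w \<in> occ False (tsubst \<sigma> s)"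
    using u by (auto simp: occ_subst UNIV_bool)
  then show ?thesis by blast
qed

lemma rbb_tsubst: "regular_bipolarly_balanced (s, t) \<Longrightarrow>
    regular_bipolarly_balanced (tsubst \<sigma> s, tsubst \<sigma> t)"
  unfolding rbb_iff using bipolar_tsubst[of s \<sigma>] bipolar_tsubst[of t \<sigma>]
  by (elim disjE) (simp_all add: occ_subst vars_tsubst)

lemma occ_vars: "occ True t \<union> occ False t = vars t"
  using vars_occ[of t True] by simp

lemma rbb_vars: "regular_bipolarly_balanced (s, t) \<Longrightarrow> vars s = vars t"
  unfolding rbb_iff by (metis occ_vars)

lemma rbb_cases:
  assumes "regular_bipolarly_balanced (s, t)"
  obtains "occ True s = occ True t" "occ False s = occ False t"
  | "occ True s \<inter> occ False s \<noteq> {}" "occ True t \<inter> occ False t \<noteq> {}"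
  using assms unfolding rbb_iff by blast

lemma rbb_balancedI: "occ True s = occ True t \<Longrightarrow> occ False s = occ False t \<Longrightarrow>
    regular_bipolarly_balanced (s, t)"
  unfolding rbb_iff by (simp add: all_bool_eq)

lemma rbb_bipolarI: "vars s = vars t \<Longrightarrow> occ True s \<inter> occ False s \<noteq> {} \<Longrightarrow>
    occ True t \<inter> occ False t \<noteq> {} \<Longrightarrow> regular_bipolarly_balanced (s, t)"
  unfolding rbb_iff by simp

lemma rbb_refl: "regular_bipolarly_balanced (s, s)"
  by (simp add: rbb_iff)

lemma rbb_sym: "regular_bipolarly_balanced (s, t) \<Longrightarrow> regular_bipolarly_balanced (t, s)"
  by (auto simp: rbb_iff)

lemma rbb_trans:
  assumes st: "regular_bipolarly_balanced (s, t)" and tu: "regular_bipolarly_balanced (t, u)"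
  shows "regular_bipolarly_balanced (s, u)"
proof -
  have v: "vars s = vars u" using rbb_vars[OF st] rbb_vars[OF tu] by simp
  show ?thesis
    using st tu
    by (elim rbb_cases) (simp_all add: rbb_balancedI rbb_bipolarI[OF v])
qed

lemmas rbb_equiv = rbb_refl rbb_sym rbb_trans

lemma rbb_neg:
  assumes "regular_bipolarly_balanced (s, t)"
  shows "regular_bipolarly_balanced (\<^bold>\<not>s, \<^bold>\<not>t)"
  using assms
proof (cases rule: rbb_cases)
  case 1 then show ?thesis by (intro rbb_balancedI) simp_all
next
  case 2 then show ?thesis
    using rbb_vars[OF assms] by (intro rbb_bipolarI) (simp_all add: Int_commute)
qed

lemma rbb_binary:
  assumes st: "regular_bipolarly_balanced (s, t)" and st': "regular_bipolarly_balanced (s', t')"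
  shows "regular_bipolarly_balanced (s \<^bold>\<and> s', t \<^bold>\<and> t')"
    and "regular_bipolarly_balanced (s \<^bold>\<or> s', t \<^bold>\<or> t')"
proof -
  consider "\<forall>q. occ q s = occ q t" "\<forall>q. occ q s' = occ q t'"
    | "occ True s \<inter> occ False s \<noteq> {}" "occ True t \<inter> occ False t \<noteq> {}"
    | "occ True s' \<inter> occ False s' \<noteq> {}" "occ True t' \<inter> occ False t' \<noteq> {}"
    using st st' unfolding rbb_iff by argo
  then have "(\<forall>q. occ q s \<union> occ q s' = occ q t \<union> occ q t') \<or>
      (occ True s \<union> occ True s') \<inter> (occ False s \<union> occ False s') \<noteq> {} \<and>
      (occ True t \<union> occ True t') \<inter> (occ False t \<union> occ False t') \<noteq> {}"
    by cases (simp, blast, blast)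
  then show "regular_bipolarly_balanced (s \<^bold>\<and> s', t \<^bold>\<and> t')"
    and "regular_bipolarly_balanced (s \<^bold>\<or> s', t \<^bold>\<or> t')"
    using rbb_vars[OF st] rbb_vars[OF st'] unfolding rbb_iff by simp_all
qed

lemmas rbb_cong = rbb_neg rbb_binary

text \<open>The witness is the quotient of the term algebra.\<close>

theorem Idt_RBip:
  assumes V: "\<forall>A\<in>V. algebra A"
  shows "Idt (RBip V :: nat trm set alg set) = {e \<in> Idt V. regular_bipolarly_balanced e}"
proof
  define \<theta> where "\<theta> = {e \<in> Idt V. regular_bipolarly_balanced e}"
  have \<theta>I: "(s, t) \<in> \<theta> \<longleftrightarrow> regular_bipolarly_balanced (s, t) \<and>
      (\<forall>A\<in>V. \<forall>v. range v \<subseteq> carrier A \<longrightarrow> eval A v s = eval A v t)" for s t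
    by (auto simp: \<theta>_def Idt_def satisfies_def)
  have eqv: "(s, s) \<in> \<theta>" "(s, t) \<in> \<theta> \<Longrightarrow> (t, s) \<in> \<theta>"
      "(s, t) \<in> \<theta> \<Longrightarrow> (t, u) \<in> \<theta> \<Longrightarrow> (s, u) \<in> \<theta>" for s t u
    unfolding \<theta>I using rbb_refl rbb_sym rbb_trans by metis+
  have cong: "(s, t) \<in> \<theta> \<Longrightarrow> (\<^bold>\<not>s, \<^bold>\<not>t) \<in> \<theta>"
      "(s, t) \<in> \<theta> \<Longrightarrow> (s', t') \<in> \<theta> \<Longrightarrow> (s \<^bold>\<and> s', t \<^bold>\<and> t') \<in> \<theta>"
      "(s, t) \<in> \<theta> \<Longrightarrow> (s', t') \<in> \<theta> \<Longrightarrow> (s \<^bold>\<or> s', t \<^bold>\<or> t') \<in> \<theta>" for s t s' t'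
    unfolding \<theta>I by (simp_all add: rbb_neg rbb_binary)
  have sub: "(tsubst \<sigma> s, tsubst \<sigma> t) \<in> \<theta>" if "(s, t) \<in> \<theta>" for \<sigma> s t
  proof -
    have "range (\<lambda>u. eval A v (\<sigma> u)) \<subseteq> carrier A" if "A \<in> V" "range v \<subseteq> carrier A" for A v
      using V that by (auto intro: eval_closed)
    then show ?thesis using that unfolding \<theta>I by (auto simp: eval_subst intro!: rbb_tsubst)
  qed
  define cl where "cl t = {s. (s, t) \<in> \<theta>}" for t
  define rep where "rep c = (SOME t. c = cl t)" for c
  have cl_eq: "cl s = cl t \<longleftrightarrow> (s, t) \<in> \<theta>" for s t
    unfolding cl_def using eqv by blast
  have rep: "(rep (cl t), t) \<in> \<theta>" for t
    unfolding rep_def cl_eq[symmetric] by (rule someI2[of _ t]) auto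
  define Q where "Q = \<lparr>carrier = range cl, meet = (\<lambda>a b. cl (rep a \<^bold>\<and> rep b)),
     join = (\<lambda>a b. cl (rep a \<^bold>\<or> rep b)), neg = (\<lambda>a. cl (\<^bold>\<not>(rep a)))\<rparr>"
  have algQ: "algebra Q" by (auto simp: Q_def algebra_def lat_closed_def)
  have Qcl: "meet Q (cl s) (cl t) = cl (s \<^bold>\<and> t)" "join Q (cl s) (cl t) = cl (s \<^bold>\<or> t)"
      "neg Q (cl s) = cl (\<^bold>\<not>s)" for s t
    using rep by (auto simp: Q_def cl_eq intro!: cong)
  have evQ: "eval Q (\<lambda>u. cl (\<sigma> u)) t = cl (tsubst \<sigma> t)" for \<sigma> t
    by (induction t) (auto simp: Qcl)
  have "Q \<Turnstile> e" if "e \<in> \<theta>" for e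
    unfolding satisfies_def
  proof (intro allI impI)
    fix v :: "nat \<Rightarrow> nat trm set" assume "range v \<subseteq> carrier Q"
    then have "\<exists>t. v u = cl t" for u by (auto simp: Q_def image_subset_iff)
    then have "\<forall>u. v u = cl (rep (v u))" using rep eqv by (metis cl_eq)
    then have "v = (\<lambda>u. cl (rep (v u)))" by blast
    then show "eval Q v (fst e) = eval Q v (snd e)"
      using sub[of "fst e" "snd e"] that evQ[of "\<lambda>u. rep (v u)"] by (simp add: cl_eq)
  qed
  then have QM: "Q \<in> RBip V" using algQ by (simp add: RBip_def Mod_def \<theta>_def)
  have Var: "tsubst Var t = t" for t :: "nat trm" by (induction t) auto
  show "Idt (RBip V :: nat trm set alg set) \<subseteq> {e \<in> Idt V. regular_bipolarly_balanced e}"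
  proof
    fix e assume "e \<in> Idt (RBip V :: nat trm set alg set)"
    then have "Q \<Turnstile> e" using QM by (auto simp: Idt_def)
    moreover have "range (\<lambda>u. cl (Var u)) \<subseteq> carrier Q" by (auto simp: Q_def)
    ultimately have "eval Q (\<lambda>u. cl (Var u)) (fst e) = eval Q (\<lambda>u. cl (Var u)) (snd e)"
      unfolding satisfies_def by blast
    then have "e \<in> \<theta>" by (simp add: evQ Var cl_eq)
    then show "e \<in> {e \<in> Idt V. regular_bipolarly_balanced e}" by (simp add: \<theta>_def)
  qed
  show "{e \<in> Idt V. regular_bipolarly_balanced e} \<subseteq> Idt (RBip V :: nat trm set alg set)"
    by (auto simp: Idt_def RBip_def Mod_def)
qed

subsection \<open>Varieties are generated by homomorphic images of subalgebras of products\<close>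

definition alg_product :: "'i set \<Rightarrow> ('i \<Rightarrow> 'b alg) \<Rightarrow> ('i \<Rightarrow> 'b) alg" where
  "alg_product T B = \<lparr>carrier = {f. \<forall>i. if i \<in> T then f i \<in> carrier (B i) else f i = undefined},
     meet = (\<lambda>f g i. if i \<in> T then meet (B i) (f i) (g i) else undefined),
     join = (\<lambda>f g i. if i \<in> T then join (B i) (f i) (g i) else undefined),
     neg = (\<lambda>f i. if i \<in> T then neg (B i) (f i) else undefined)\<rparr>"

definition subalgebra :: "'a alg \<Rightarrow> 'a alg \<Rightarrow> bool" where
  "subalgebra C A \<longleftrightarrow> algebra C \<and> alg_hom id C A"

definition HSP :: "'i itself \<Rightarrow> 'k alg set \<Rightarrow> 'a alg set" where
  "HSP _ K = {A. algebra A \<and> (\<exists>(T :: 'i set) B C h. B ` T \<subseteq> K \<and> subalgebra C (alg_product T B) \<and>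
     alg_hom h C A \<and> h ` carrier C = carrier A)}"

theorem HSP_generated_variety:
  fixes K :: "'b alg set"
  assumes K: "\<forall>A\<in>K. algebra A"
  shows "HSP TYPE('i) K \<subseteq> (generated_variety K :: 'a alg set)"
proof
  fix A :: "'a alg" assume "A \<in> HSP TYPE('i) K"
  then obtain T :: "'i set" and B C h where A: "algebra A" and B: "B ` T \<subseteq> K"
    and C: "algebra C" "alg_hom id C (alg_product T B)" and h: "alg_hom h C A" "h ` carrier C = carrier A"
    by (auto simp: HSP_def subalgebra_def)
  have "C \<Turnstile> e" if e: "e \<in> Idt K" for e
    unfolding satisfies_def
  proof (intro allI impI)
    fix v :: "nat \<Rightarrow> 'i \<Rightarrow> 'b" assume v: "range v \<subseteq> carrier C"
    have vP: "range v \<subseteq> carrier (alg_product T B)" using alg_homD(1)[OF C(2)] v by auto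
    have ev: "eval (alg_product T B) v t i = (if i \<in> T then eval (B i) (\<lambda>u. v u i) t else undefined)" for t i
      using vP by (induction t) (auto simp: alg_product_def image_subset_iff)
    have "range (\<lambda>u. v u i) \<subseteq> carrier (B i)" if "i \<in> T" for i
      using vP that by (fastforce simp: alg_product_def image_subset_iff)
    moreover have "B i \<Turnstile> e" if "i \<in> T" for i using e B that by (auto simp: Idt_def)
    ultimately have "eval (alg_product T B) v (fst e) = eval (alg_product T B) v (snd e)"
      unfolding fun_eq_iff ev by (simp add: satisfies_def)
    then show "eval C v (fst e) = eval C v (snd e)"
      using hom_eval[OF C v] by simp
  qed
  then show "A \<in> generated_variety K"
    using A satisfies_hom_image[OF C(1) h] by (auto simp: generated_variety_eq[OF K] Mod_def)
qed

lemma finite_vars: "finite (vars t)"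
  by (induction t) auto

lemma eval_cong: "(\<And>u. u \<in> vars t \<Longrightarrow> v u = w u) \<Longrightarrow> eval A v t = eval A w t"
  by (induction t) auto

text \<open>An index for each member of \<open>K\<close> and each assignment of values in it to the elements of the
  algebra at hand is enough.\<close>

theorem generated_variety_HSP:
  fixes K :: "'k alg set"
  assumes K: "\<forall>A\<in>K. algebra A"
  shows "generated_variety K = (HSP TYPE('k alg \<times> ('a \<Rightarrow> 'k)) K :: 'a alg set)"
proof
  show "HSP TYPE('k alg \<times> ('a \<Rightarrow> 'k)) K \<subseteq> (generated_variety K :: 'a alg set)"
    by (rule HSP_generated_variety[OF K])
  show "(generated_variety K :: 'a alg set) \<subseteq> HSP TYPE('k alg \<times> ('a \<Rightarrow> 'k)) K"
  proof
    fix A :: "'a alg" assume "A \<in> generated_variety K"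
    then have A: "algebra A" "\<And>e. e \<in> Idt K \<Longrightarrow> A \<Turnstile> e"
      by (auto simp: generated_variety_eq[OF K] Mod_def)
    define T :: "('k alg \<times> ('a \<Rightarrow> 'k)) set" where "T = {(B, w). B \<in> K \<and> range w \<subseteq> carrier B}"
    let ?P = "alg_product T fst"
    define g :: "'a trm \<Rightarrow> 'k alg \<times> ('a \<Rightarrow> 'k) \<Rightarrow> 'k"
      where "g t i = (if i \<in> T then eval (fst i) (snd i) t else undefined)" for t i
    define Ts where "Ts = {t. vars t \<subseteq> carrier A}"
    define C where "C = ?P\<lparr>carrier := g ` Ts\<rparr>"
    have ops: "meet C (g s) (g t) = g (s \<^bold>\<and> t)" "join C (g s) (g t) = g (s \<^bold>\<or> t)"
        "neg C (g s) = g (\<^bold>\<not>s)" "carrier C = g ` Ts" for s t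
      by (auto simp: C_def alg_product_def g_def fun_eq_iff)
    have gP: "g t \<in> carrier ?P" for t
      using K by (auto simp: alg_product_def g_def T_def intro!: eval_closed)
    obtain a where a: "a \<in> carrier A" using alg_closed(1)[OF A(1)] by blast
    have "Var a \<in> Ts" using a by (simp add: Ts_def)
    then have algC: "algebra C"
      by (auto simp: algebra_def lat_closed_def ops) (auto simp: Ts_def)
    have "subalgebra C ?P"
      using gP algC by (auto simp: subalgebra_def C_def intro!: alg_homI)
    moreover
    define val where "val = (\<lambda>b. if b \<in> carrier A then b else a)"
    have val: "range val \<subseteq> carrier A" using a by (auto simp: val_def)
    have key: "eval A val s = eval A val t" if st: "s \<in> Ts" "t \<in> Ts" "g s = g t" for s t
    proof -
      have "finite (vars s \<union> vars t)" by (simp add: finite_vars)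
      then obtain f :: "'a \<Rightarrow> nat" where f: "inj_on f (vars s \<union> vars t)"
        using finite_imp_inj_to_nat_seg by metis
      let ?f = "inv_into (vars s \<union> vars t) f"
      define \<sigma> where "\<sigma> u = (Var (f u) :: nat trm)" for u
      have ev: "eval B v (tsubst \<sigma> r) = eval B (\<lambda>u. v (f u)) r" for B :: "'k alg" and v r
        by (simp add: eval_subst \<sigma>_def)
      have ev': "eval A v (tsubst \<sigma> r) = eval A (\<lambda>u. v (f u)) r" for v r
        by (simp add: eval_subst \<sigma>_def)
      have "(tsubst \<sigma> s, tsubst \<sigma> t) \<in> Idt K"
        unfolding Idt_def satisfies_def
      proof (clarsimp simp: ev)
        fix B and v :: "nat \<Rightarrow> 'k" assume "B \<in> K" "range v \<subseteq> carrier B"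
        then have "(B, \<lambda>u. v (f u)) \<in> T" by (auto simp: T_def)
        then show "eval B (\<lambda>u. v (f u)) s = eval B (\<lambda>u. v (f u)) t"
          using fun_cong[OF st(3), of "(B, \<lambda>u. v (f u))"] by (simp add: g_def)
      qed
      then have "A \<Turnstile> (tsubst \<sigma> s, tsubst \<sigma> t)" by (rule A(2))
      moreover have "range (\<lambda>m. val (?f m)) \<subseteq> carrier A" using val by auto
      ultimately have "eval A (\<lambda>u. val (?f (f u))) s = eval A (\<lambda>u. val (?f (f u))) t"
        unfolding satisfies_def fst_conv snd_conv ev' by fast
      moreover have "eval A (\<lambda>u. val (?f (f u))) s = eval A val s"
        "eval A (\<lambda>u. val (?f (f u))) t = eval A val t"
        by (auto intro!: eval_cong simp: f)
      ultimately show ?thesis by simp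
    qed
    define h where "h c = eval A val (SOME t. t \<in> Ts \<and> g t = c)" for c
    have h: "h (g t) = eval A val t" if "t \<in> Ts" for t
    proof -
      let ?s = "SOME s. s \<in> Ts \<and> g s = g t"
      have "?s \<in> Ts \<and> g ?s = g t" by (rule someI[of _ t]) (simp add: that)
      then show ?thesis unfolding h_def using key that by blast
    qed
    have "alg_hom h C A"
    proof (rule alg_homI; clarsimp simp: ops)
      show "\<And>t. t \<in> Ts \<Longrightarrow> h (g t) \<in> carrier A" using h val A(1) by (simp add: eval_closed)
    qed (simp_all add: h Ts_def)
    moreover have "h ` carrier C = carrier A"
    proof
      show "h ` carrier C \<subseteq> carrier A" using h val A(1) by (auto simp: ops eval_closed)
      show "carrier A \<subseteq> h ` carrier C"
      proof
        fix b assume b: "b \<in> carrier A"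
        then have "h (g (Var b)) = b" "Var b \<in> Ts" by (simp_all add: Ts_def h val_def)
        then show "b \<in> h ` carrier C" unfolding ops by (metis imageI)
      qed
    qed
    moreover have "fst ` T \<subseteq> K" by (auto simp: T_def)
    ultimately show "A \<in> HSP TYPE('k alg \<times> ('a \<Rightarrow> 'k)) K"
      using A(1) unfolding HSP_def by blast
  qed
qed

subsection \<open>Systems on arbitrary types\<close>

context dm_system
begin

lemma fibre_of_eq: "i \<in> carrier S \<Longrightarrow> a \<in> carrier (F i) \<Longrightarrow> fibre_of S F a = i"
  unfolding fibre_of_def using disjoint by (intro the_equality) auto

lemma index_algebra: "algebra S"
  using index by (simp add: InvSL_def Mod_def)

lemma fibre_closed:
  assumes "i \<in> carrier S"
  shows "carrier (F i) \<noteq> {}"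
    and "a \<in> carrier (F i) \<Longrightarrow> b \<in> carrier (F i) \<Longrightarrow> meet (F i) a b \<in> carrier (F i)"
    and "a \<in> carrier (F i) \<Longrightarrow> b \<in> carrier (F i) \<Longrightarrow> join (F i) a b \<in> carrier (F i)"
  using fibre[OF assms] by (auto simp: distributive_lattice_def lat_closed_def)

lemma trans_closed: "isl_le S i j \<Longrightarrow> a \<in> carrier (F i) \<Longrightarrow> p i j a \<in> carrier (F j)"
  using trans_hom unfolding lat_hom_def by blast

lemma neg_closed: "i \<in> carrier S \<Longrightarrow> a \<in> carrier (F i) \<Longrightarrow> n i a \<in> carrier (F (neg S i))"
  using neg_bij bij_betwE by metis

end

lemma InvSL_D:
  assumes "S \<in> InvSL"
  shows "i \<in> carrier S \<Longrightarrow> join S i i = i"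
    and "i \<in> carrier S \<Longrightarrow> j \<in> carrier S \<Longrightarrow> join S i j = join S j i"
    and "i \<in> carrier S \<Longrightarrow> j \<in> carrier S \<Longrightarrow> k \<in> carrier S \<Longrightarrow>
      join S (join S i j) k = join S i (join S j k)"
    and "i \<in> carrier S \<Longrightarrow> j \<in> carrier S \<Longrightarrow> neg S (join S i j) = join S (neg S i) (neg S j)"
proof -
  have ax: "S \<Turnstile> \<^bold>x \<^bold>\<or> \<^bold>x \<doteq> \<^bold>x" "S \<Turnstile> \<^bold>x \<^bold>\<or> \<^bold>y \<doteq> \<^bold>y \<^bold>\<or> \<^bold>x"
    "S \<Turnstile> (\<^bold>x \<^bold>\<or> \<^bold>y) \<^bold>\<or> \<^bold>z \<doteq> \<^bold>x \<^bold>\<or> (\<^bold>y \<^bold>\<or> \<^bold>z)"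
    "S \<Turnstile> \<^bold>\<not>(\<^bold>x \<^bold>\<or> \<^bold>y) \<doteq> \<^bold>\<not>\<^bold>x \<^bold>\<or> \<^bold>\<not>\<^bold>y"
    using assms by (auto simp: InvSL_def Mod_def)
  have v: "range (\<lambda>m::nat. if m = 0 then i else if m = 1 then j else k) \<subseteq> carrier S"
    if "i \<in> carrier S" "j \<in> carrier S" "k \<in> carrier S" for i j k
    using that by auto
  note inst = ax[unfolded satisfies_def, rule_format, OF v, simplified]
  show "i \<in> carrier S \<Longrightarrow> join S i i = i"
    and "i \<in> carrier S \<Longrightarrow> j \<in> carrier S \<Longrightarrow> join S i j = join S j i"
    and "i \<in> carrier S \<Longrightarrow> j \<in> carrier S \<Longrightarrow> k \<in> carrier S \<Longrightarrow>
      join S (join S i j) k = join S i (join S j k)"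
    and "i \<in> carrier S \<Longrightarrow> j \<in> carrier S \<Longrightarrow> neg S (join S i j) = join S (neg S i) (neg S j)"
    using inst by blast+
qed

lemma isl_le_join:
  assumes "S \<in> InvSL" "i \<in> carrier S" "j \<in> carrier S"
  shows "isl_le S i (join S i j)" "isl_le S j (join S i j)"
proof -
  have "join S i j \<in> carrier S" using assms by (auto simp: InvSL_def Mod_def intro: alg_closed)
  then show "isl_le S i (join S i j)" "isl_le S j (join S i j)"
    using assms by (simp_all add: isl_le_def) (metis InvSL_D(1-3))+
qed

lemma Mod_copy:
  assumes "A \<in> Mod \<Sigma>" "inj_on f (carrier A)"
  shows "copy f A \<in> Mod \<Sigma>"
proof -
  have A: "algebra A" using assms by (simp add: Mod_def)
  note c = copy[OF A assms(2)]
  have "f ` carrier A = carrier (copy f A)" using c(4) by (simp add: bij_betw_def)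
  then show ?thesis
    using satisfies_hom_image[OF A c(2)] assms(1) c(1) by (auto simp: Mod_def)
qed

theorem dmp_sumsI:
  fixes A :: "'a alg" and S :: "'i alg" and F :: "'i \<Rightarrow> 'b lat"
  assumes K: "\<forall>B\<in>K. algebra B" and S: "S \<in> generated_variety K"
    and sys: "dm_system S F p n" and A: "algebra A" "A \<cong> dmp_sum S F p n"
  shows "A \<in> dmp_sums (generated_variety K)"
proof -
  interpret dm_system S F p n by (rule sys)
  let ?D = "dmp_sum S F p n"
  obtain h where h: "alg_hom h A ?D" "bij_betw h (carrier A) (carrier ?D)"
    using A(2) by (auto simp: isomorphic_def)
  define g where "g = inv_into (carrier A) h"
  have D: "carrier ?D = (\<Union>i\<in>carrier S. carrier (F i))" by (simp add: dmp_sum_def)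
  have gh: "g (h x) = x" if "x \<in> carrier A" for x
    using h(2) that by (simp add: g_def bij_betw_def)
  have hg: "h (g u) = u" and gA: "g u \<in> carrier A" if "i \<in> carrier S" "u \<in> carrier (F i)" for u i
  proof -
    have "u \<in> h ` carrier A" using that h(2) D by (auto simp: bij_betw_def)
    then show "h (g u) = u" "g u \<in> carrier A"
      by (simp_all add: g_def f_inv_into_f inv_into_into)
  qed
  define r where "r i = g (SOME u. u \<in> carrier (F i))" for i
  have some: "(SOME u. u \<in> carrier (F i)) \<in> carrier (F i)" if "i \<in> carrier S" for i
    using fibre_closed(1)[OF that] by (simp add: some_in_eq)
  have r: "inj_on r (carrier S)"
  proof (rule inj_onI)
    fix i j assume ij: "i \<in> carrier S" "j \<in> carrier S" "r i = r j"
    then have "(SOME u. u \<in> carrier (F i)) = (SOME u. u \<in> carrier (F j))"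
      unfolding r_def by (metis hg some)
    then show "i = j" using disjoint[OF ij(1,2)] some[OF ij(1)] some[OF ij(2)] by auto
  qed
  define q where "q = inv_into (carrier S) r"
  have qr[simp]: "q (r i) = i" if "i \<in> carrier S" for i using r that by (simp add: q_def)
  define S' where "S' = copy r S"
  define F' where "F' a = \<lparr>carrier = g ` carrier (F (q a)),
     meet = (\<lambda>u v. g (meet (F (q a)) (h u) (h v))), join = (\<lambda>u v. g (join (F (q a)) (h u) (h v)))\<rparr>" for a
  define p' where "p' a b u = g (p (q a) (q b) (h u))" for a b u
  define n' where "n' a u = g (n (q a) (h u))" for a u
  have S': "carrier S' = r ` carrier S"
    "\<And>i j. i \<in> carrier S \<Longrightarrow> j \<in> carrier S \<Longrightarrow> join S' (r i) (r j) = r (join S i j)"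
    "\<And>i. i \<in> carrier S \<Longrightarrow> neg S' (r i) = r (neg S i)"
    by (simp_all add: S'_def copy_def q_def[symmetric])
  have le: "isl_le S' (r i) (r j) \<longleftrightarrow> isl_le S i j" if "i \<in> carrier S" "j \<in> carrier S" for i j
    using that inj_onD[OF r, of "join S i j" j] alg_closed(3)[OF index_algebra, of i j]
    by (auto simp: isl_le_def S')
  have nS: "neg S i \<in> carrier S" if "i \<in> carrier S" for i
    using alg_closed(4)[OF index_algebra that] .
  have jS: "join S i j \<in> carrier S" if "i \<in> carrier S" "j \<in> carrier S" for i j
    using alg_closed(3)[OF index_algebra that] .
  have ginj: "inj_on g (carrier ?D)"
  proof (rule inj_on_inverseI)
    show "h (g u) = u" if "u \<in> carrier ?D" for u using that hg by (auto simp: D)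
  qed
  have sys': "dm_system S' F' p' n'"
  proof
    show "S' \<in> InvSL" using index r unfolding S'_def InvSL_def by (rule Mod_copy)
  next
    fix i assume "i \<in> carrier S'"
    then obtain i0 where i0: "i = r i0" "i0 \<in> carrier S" by (auto simp: S')
    show "distributive_lattice (F' i)"
    proof -
      let ?L = "F i0"
      have laws: "meet ?L a b = meet ?L b a \<and> join ?L a b = join ?L b a \<and>
          meet ?L (meet ?L a b) c = meet ?L a (meet ?L b c) \<and>
          join ?L (join ?L a b) c = join ?L a (join ?L b c) \<and>
          meet ?L a (join ?L a b) = a \<and> join ?L a (meet ?L a b) = a \<and>
          meet ?L a (join ?L b c) = join ?L (meet ?L a b) (meet ?L a c)"
        if "a \<in> carrier ?L" "b \<in> carrier ?L" "c \<in> carrier ?L" for a b c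
        using fibre[OF i0(2)] that unfolding distributive_lattice_def by blast
      show ?thesis
        unfolding distributive_lattice_def lat_closed_def F'_def i0(1)
        by (simp add: i0(2) hg[OF i0(2)] fibre_closed[OF i0(2)])
          (intro ballI conjI arg_cong[where f = g]; use laws in blast)
    qed
  next
    fix i j assume "i \<in> carrier S'" "j \<in> carrier S'" "i \<noteq> j"
    then obtain i0 j0 where ij: "i = r i0" "i0 \<in> carrier S" "j = r j0" "j0 \<in> carrier S" "i0 \<noteq> j0"
      by (auto simp: S')
    show "carrier (F' i) \<inter> carrier (F' j) = {}"
      using disjoint[OF ij(2,4,5)] hg[OF ij(2)] hg[OF ij(4)]
      by (auto simp: F'_def ij) (metis disjoint_iff)
  next
    fix i j assume "isl_le S' i j"
    then obtain i0 j0 where ij: "i = r i0" "i0 \<in> carrier S" "j = r j0" "j0 \<in> carrier S" "isl_le S i0 j0"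
      using le by (auto simp: S' isl_le_def[of S'])
    show "lat_hom (p' i j) (F' i) (F' j)"
      using trans_hom[OF ij(5)]
      by (simp add: lat_hom_def image_subset_iff F'_def p'_def ij hg[OF ij(2)] hg[OF ij(4)]
          fibre_closed[OF ij(2)])
  next
    fix i u assume "i \<in> carrier S'" "u \<in> carrier (F' i)"
    then obtain i0 u0 where i: "i = r i0" "i0 \<in> carrier S" "u = g u0" "u0 \<in> carrier (F i0)"
      by (auto simp: S' F'_def)
    show "p' i i u = u" using i by (simp add: p'_def hg[OF i(2)] trans_id)
  next
    fix i j k u assume "isl_le S' i j" "isl_le S' j k" and u: "u \<in> carrier (F' i)"
    then obtain i0 j0 k0 where ij: "i = r i0" "i0 \<in> carrier S" "j = r j0" "j0 \<in> carrier S"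
       "k = r k0" "k0 \<in> carrier S" "isl_le S i0 j0" "isl_le S j0 k0"
      using le by (auto simp: S' isl_le_def[of S'])
    then obtain u0 where u0: "u = g u0" "u0 \<in> carrier (F i0)" using u by (auto simp: F'_def)
    show "p' j k (p' i j u) = p' i k u"
      using trans_comp[OF ij(7,8) u0(2)] trans_closed[OF ij(7) u0(2)]
      by (simp add: p'_def ij u0 hg[OF ij(2)] hg[OF ij(4)])
  next
    fix i assume "i \<in> carrier S'"
    then obtain i0 where i0: "i = r i0" "i0 \<in> carrier S" by (auto simp: S')
    have "inj_on g (carrier (F m))" if "m \<in> carrier S" for m
      using that by (intro inj_on_subset[OF ginj]) (auto simp: D)
    then have b: "bij_betw g (carrier (F i0)) (carrier (F' i))"
       "bij_betw g (carrier (F (neg S i0))) (carrier (F' (neg S' i)))"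
      using i0 nS by (auto simp: bij_betw_def F'_def S')
    have "bij_betw h (carrier (F' i)) (carrier (F i0))"
      by (rule bij_betw_byWitness[where f' = g]) (auto simp: F'_def i0 hg[OF i0(2)])
    from bij_betw_trans[OF this bij_betw_trans[OF neg_bij[OF i0(2)] b(2)]]
    show "bij_betw (n' i) (carrier (F' i)) (carrier (F' (neg S' i)))"
      by (rule bij_betw_cong[THEN iffD1, rotated]) (simp add: n'_def i0)
  next
    fix i u v assume "i \<in> carrier S'" "u \<in> carrier (F' i)" "v \<in> carrier (F' i)"
    then obtain i0 u0 v0 where i: "i = r i0" "i0 \<in> carrier S" "u = g u0" "u0 \<in> carrier (F i0)"
        "v = g v0" "v0 \<in> carrier (F i0)"
      by (auto simp: S' F'_def)
    show "n' i (meet (F' i) u v) = join (F' (neg S' i)) (n' i u) (n' i v)"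
      "n' i (join (F' i) u v) = meet (F' (neg S' i)) (n' i u) (n' i v)"
      using i nS[OF i(2)]
      by (simp_all add: n'_def F'_def S' hg[OF i(2)] hg[OF nS[OF i(2)]] fibre_closed[OF i(2)]
          neg_closed[OF i(2)] neg_meet neg_join)
  next
    fix i u assume "i \<in> carrier S'" "u \<in> carrier (F' i)"
    then obtain i0 u0 where i: "i = r i0" "i0 \<in> carrier S" "u = g u0" "u0 \<in> carrier (F i0)"
      by (auto simp: S' F'_def)
    show "n' (neg S' i) (n' i u) = u"
      using i nS[OF i(2)] neg_closed[OF i(2,4)] neg_inverse[OF i(2,4)]
      by (simp add: n'_def S' hg[OF i(2)] hg[OF nS[OF i(2)]])
  next
    fix i j u assume "isl_le S' i j" and u: "u \<in> carrier (F' i)"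
    then obtain i0 j0 where ij: "i = r i0" "i0 \<in> carrier S" "j = r j0" "j0 \<in> carrier S" "isl_le S i0 j0"
      using le by (auto simp: S' isl_le_def[of S'])
    then obtain u0 where u0: "u = g u0" "u0 \<in> carrier (F i0)" using u by (auto simp: F'_def)
    show "n' j (p' i j u) = p' (neg S' i) (neg S' j) (n' i u)"
      using neg_trans[OF ij(5) u0(2)] trans_closed[OF ij(5) u0(2)] neg_closed[OF ij(2) u0(2)]
        nS[OF ij(2)] nS[OF ij(4)]
      by (simp add: n'_def p'_def S' ij u0 hg[OF ij(2)] hg[OF ij(4)] hg[OF nS[OF ij(2)]])
  qed
  then interpret T: dm_system S' F' p' n' .
  let ?D' = "dmp_sum S' F' p' n'"
  have fib: "\<exists>i. i \<in> carrier S \<and> h u \<in> carrier (F i) \<and> fibre_of S F (h u) = i \<and> fibre_of S' F' u = r i"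
    if "u \<in> carrier A" for u
  proof -
    have "h u \<in> carrier ?D" using alg_homD(1)[OF h(1) that] .
    then obtain i where i: "i \<in> carrier S" "h u \<in> carrier (F i)" by (auto simp: D)
    have "u \<in> carrier (F' (r i))" using i gh[OF that] by (force simp: F'_def)
    then show ?thesis using i fibre_of_eq T.fibre_of_eq S' by auto
  qed
  have "alg_hom id A ?D'"
  proof (rule alg_homI)
    fix u assume u: "u \<in> carrier A"
    then obtain i where i: "i \<in> carrier S" "h u \<in> carrier (F i)" "fibre_of S F (h u) = i"
      "fibre_of S' F' u = r i" using fib by blast
    show "id u \<in> carrier ?D'" using i gh[OF u] by (force simp: dmp_sum_def F'_def S')
    have "neg A u = g (neg ?D (h u))"
      using gh[OF alg_closed(4)[OF A(1) u]] alg_homD(4)[OF h(1) u] by simp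
    then show "id (neg A u) = neg ?D' (id u)" using i by (simp add: dmp_sum_def n'_def)
  next
    fix u v assume u: "u \<in> carrier A" and v: "v \<in> carrier A"
    obtain i where i: "i \<in> carrier S" "h u \<in> carrier (F i)" "fibre_of S F (h u) = i"
      "fibre_of S' F' u = r i" using fib[OF u] by blast
    obtain j where j: "j \<in> carrier S" "h v \<in> carrier (F j)" "fibre_of S F (h v) = j"
      "fibre_of S' F' v = r j" using fib[OF v] by blast
    let ?k = "join S i j"
    have k: "?k \<in> carrier S" using jS i j by blast
    have pc: "p i ?k (h u) \<in> carrier (F ?k)" "p j ?k (h v) \<in> carrier (F ?k)"
      using isl_le_join[OF index i(1) j(1)] trans_closed i(2) j(2) by blast+
    have "meet A u v = g (meet ?D (h u) (h v))"
      using gh[OF alg_closed(2)[OF A(1) u v]] alg_homD(2)[OF h(1) u v] by simp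
    then show "id (meet A u v) = meet ?D' (id u) (id v)"
      using i j k pc by (simp add: dmp_sum_def Let_def S' p'_def F'_def hg[OF k])
    have "join A u v = g (join ?D (h u) (h v))"
      using gh[OF alg_closed(3)[OF A(1) u v]] alg_homD(3)[OF h(1) u v] by simp
    then show "id (join A u v) = join ?D' (id u) (id v)"
      using i j k pc by (simp add: dmp_sum_def Let_def S' p'_def F'_def hg[OF k])
  qed
  moreover have "carrier ?D' = carrier A"
  proof
    show "carrier ?D' \<subseteq> carrier A" using gA by (auto simp: dmp_sum_def S' F'_def)
    show "carrier A \<subseteq> carrier ?D'" using alg_homD(1)[OF calculation] by auto
  qed
  ultimately have "A \<cong> ?D'" unfolding isomorphic_def by (metis bij_betw_id)
  moreover have "S' \<in> generated_variety K"
    using S Mod_copy[OF _ r] unfolding S'_def generated_variety_eq[OF K] by blast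
  ultimately show ?thesis using A(1) sys' unfolding dmp_sums_def by blast
qed

lemma algebra_DM4_IS2_IS3: "algebra DM4" "algebra IS2" "algebra IS3"
  by (auto simp: algebra_def lat_closed_def DM4_def IS2_def IS3_def)

end

theory Submission
  imports Defs
begin

text \<open>The classes form a cycle of inclusions
  \<open>V(DM4, IS2, IS3) \<subseteq> R(Bip(DML)) \<subseteq> RBDMBL \<subseteq> sums \<subseteq> V(DM4, IS2, IS3)\<close>.
  A De Morgan bisemilattice is decomposed by the partition function \<open>d x y = x \<and> (x \<or> y)\<close>; the index
  semilattice inherits the bipolar axiom, which forces an element above some \<open>i \<or> \<not>i\<close> to be fixed by
  negation, and this suffices to separate elements by homomorphisms into \<open>IS2\<close> and \<open>IS3\<close>.
  Conversely, a sum satisfies every identity that holds both in its index semilattice and in all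
  De Morgan lattices: if \<open>k\<close> is the fibre of both sides, transport all values into the De Morgan lattice
  \<open>F k \<times> F (\<not>k)\<close> with negation swapping the factors; its first component computes both sides.
  Prime filters show that \<open>DM4\<close> satisfies no more identities than all De Morgan lattices.\<close>

section \<open>De Morgan bisemilattices\<close>

text \<open>Meant for identities in the variables 0, 1 and 2; every later variable is sent to
  \<open>c\<close>, so the assignment stays in the carrier.\<close>

lemma satisfies_instance:
  assumes "A \<Turnstile> e" "a \<in> carrier A" "b \<in> carrier A" "c \<in> carrier A"
  shows "eval A (\<lambda>m. if m = 0 then a else if m = 1 then b else c) (fst e) =
    eval A (\<lambda>m. if m = 0 then a else if m = 1 then b else c) (snd e)"
proof -
  have "range (\<lambda>m::nat. if m = 0 then a else if m = 1 then b else c) \<subseteq> carrier A"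
    using assms by auto
  then show ?thesis using assms(1) unfolding satisfies_def by blast
qed

locale de_morgan_bisemilattice =
  fixes A :: "'a alg"
  assumes DMBL: "A \<in> DMBL"
begin

abbreviation mt  (infixl "\<sqinter>" 70) where "x \<sqinter> y \<equiv> meet A x y"
abbreviation jn  (infixl "\<squnion>" 65) where "x \<squnion> y \<equiv> join A x y"
abbreviation ng  ("\<sim>_" [80] 80) where "\<sim>x \<equiv> neg A x"
abbreviation "C \<equiv> carrier A"

lemma alg: "algebra A"
  using DMBL by (simp add: DMBL_def Mod_def)

lemma closed [simp, intro]:
  "x \<in> C \<Longrightarrow> y \<in> C \<Longrightarrow> x \<sqinter> y \<in> C" "x \<in> C \<Longrightarrow> y \<in> C \<Longrightarrow> x \<squnion> y \<in> C" "x \<in> C \<Longrightarrow> \<sim>x \<in> C"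
  using alg_closed[OF alg] by blast+

lemma laws:
  assumes x: "x \<in> C"
  shows idem: "x \<sqinter> x = x" "x \<squnion> x = x"
    and neg_neg: "\<sim>(\<sim>x) = x"
    and comm: "y \<in> C \<Longrightarrow> x \<sqinter> y = y \<sqinter> x" "y \<in> C \<Longrightarrow> x \<squnion> y = y \<squnion> x"
    and de_morgan: "y \<in> C \<Longrightarrow> \<sim>(x \<sqinter> y) = \<sim>x \<squnion> \<sim>y" "y \<in> C \<Longrightarrow> \<sim>(x \<squnion> y) = \<sim>x \<sqinter> \<sim>y"
    and assoc: "y \<in> C \<Longrightarrow> z \<in> C \<Longrightarrow> x \<sqinter> y \<sqinter> z = x \<sqinter> (y \<sqinter> z)"
      "y \<in> C \<Longrightarrow> z \<in> C \<Longrightarrow> x \<squnion> y \<squnion> z = x \<squnion> (y \<squnion> z)"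
    and distrib: "y \<in> C \<Longrightarrow> z \<in> C \<Longrightarrow> x \<sqinter> (y \<squnion> z) = x \<sqinter> y \<squnion> x \<sqinter> z"
      "y \<in> C \<Longrightarrow> z \<in> C \<Longrightarrow> x \<squnion> y \<sqinter> z = (x \<squnion> y) \<sqinter> (x \<squnion> z)"
proof -
  have ax: "A \<Turnstile> \<^bold>x \<^bold>\<and> \<^bold>x \<doteq> \<^bold>x" "A \<Turnstile> \<^bold>x \<^bold>\<and> \<^bold>y \<doteq> \<^bold>y \<^bold>\<and> \<^bold>x" "A \<Turnstile> (\<^bold>x \<^bold>\<and> \<^bold>y) \<^bold>\<and> \<^bold>z \<doteq> \<^bold>x \<^bold>\<and> (\<^bold>y \<^bold>\<and> \<^bold>z)"
     "A \<Turnstile> \<^bold>x \<^bold>\<or> \<^bold>x \<doteq> \<^bold>x" "A \<Turnstile> \<^bold>x \<^bold>\<or> \<^bold>y \<doteq> \<^bold>y \<^bold>\<or> \<^bold>x" "A \<Turnstile> (\<^bold>x \<^bold>\<or> \<^bold>y) \<^bold>\<or> \<^bold>z \<doteq> \<^bold>x \<^bold>\<or> (\<^bold>y \<^bold>\<or> \<^bold>z)"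
     "A \<Turnstile> \<^bold>x \<^bold>\<and> (\<^bold>y \<^bold>\<or> \<^bold>z) \<doteq> (\<^bold>x \<^bold>\<and> \<^bold>y) \<^bold>\<or> (\<^bold>x \<^bold>\<and> \<^bold>z)"
     "A \<Turnstile> \<^bold>x \<^bold>\<or> (\<^bold>y \<^bold>\<and> \<^bold>z) \<doteq> (\<^bold>x \<^bold>\<or> \<^bold>y) \<^bold>\<and> (\<^bold>x \<^bold>\<or> \<^bold>z)"
     "A \<Turnstile> \<^bold>\<not>(\<^bold>\<not>\<^bold>x) \<doteq> \<^bold>x" "A \<Turnstile> \<^bold>\<not>(\<^bold>x \<^bold>\<and> \<^bold>y) \<doteq> \<^bold>\<not>\<^bold>x \<^bold>\<or> \<^bold>\<not>\<^bold>y" "A \<Turnstile> \<^bold>\<not>(\<^bold>x \<^bold>\<or> \<^bold>y) \<doteq> \<^bold>\<not>\<^bold>x \<^bold>\<and> \<^bold>\<not>\<^bold>y"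
    using DMBL by (auto simp: DMBL_def Mod_def dmbl_axioms_def)
  note inst = ax[THEN satisfies_instance, OF x, simplified]
  show "x \<sqinter> x = x" "x \<squnion> x = x" "\<sim>(\<sim>x) = x"
    \<comment> \<open>Variables that do not occur in an identity are filled with \<open>x\<close>
      itself.\<close>
    by (fact inst(1)[OF x x] inst(4)[OF x x] inst(9)[OF x x])+
  show "y \<in> C \<Longrightarrow> x \<sqinter> y = y \<sqinter> x" "y \<in> C \<Longrightarrow> x \<squnion> y = y \<squnion> x"
    "y \<in> C \<Longrightarrow> \<sim>(x \<sqinter> y) = \<sim>x \<squnion> \<sim>y" "y \<in> C \<Longrightarrow> \<sim>(x \<squnion> y) = \<sim>x \<sqinter> \<sim>y"
    by (fact inst(2)[OF _ x] inst(5)[OF _ x] inst(10)[OF _ x] inst(11)[OF _ x])+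
  show "y \<in> C \<Longrightarrow> z \<in> C \<Longrightarrow> x \<sqinter> y \<sqinter> z = x \<sqinter> (y \<sqinter> z)"
    "y \<in> C \<Longrightarrow> z \<in> C \<Longrightarrow> x \<squnion> y \<squnion> z = x \<squnion> (y \<squnion> z)"
    "y \<in> C \<Longrightarrow> z \<in> C \<Longrightarrow> x \<sqinter> (y \<squnion> z) = x \<sqinter> y \<squnion> x \<sqinter> z"
    "y \<in> C \<Longrightarrow> z \<in> C \<Longrightarrow> x \<squnion> y \<sqinter> z = (x \<squnion> y) \<sqinter> (x \<squnion> z)"
    by (fact inst(3) inst(6) inst(7) inst(8))+
qed

lemma left_comm:
  assumes "x \<in> C" "y \<in> C" "z \<in> C"
  shows "x \<sqinter> (y \<sqinter> z) = y \<sqinter> (x \<sqinter> z)" "x \<squnion> (y \<squnion> z) = y \<squnion> (x \<squnion> z)"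
  using assms by (metis assoc comm)+

lemma left_idem:
  assumes "x \<in> C" "y \<in> C"
  shows "x \<sqinter> (x \<sqinter> y) = x \<sqinter> y" "x \<squnion> (x \<squnion> y) = x \<squnion> y"
  using assms by (metis assoc idem)+

lemmas aci = idem assoc comm left_comm left_idem

lemma distrib_right:
  assumes "x \<in> C" "y \<in> C" "z \<in> C"
  shows "(y \<squnion> z) \<sqinter> x = y \<sqinter> x \<squnion> z \<sqinter> x"
  using assms by (metis comm closed distrib)


subsection \<open>The partition function\<close>

definition d :: "'a \<Rightarrow> 'a \<Rightarrow> 'a" where
  "d x y = x \<sqinter> (x \<squnion> y)"

lemma d_closed [simp, intro]: "x \<in> C \<Longrightarrow> y \<in> C \<Longrightarrow> d x y \<in> C"
  by (simp add: d_def)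

text \<open>Distributivity and idempotency suffice, without absorption. So \<open>d\<close> is
  self-dual and therefore commutes with negation.\<close>

lemma d_dual: "x \<in> C \<Longrightarrow> y \<in> C \<Longrightarrow> d x y = x \<squnion> x \<sqinter> y"
  by (simp add: d_def distrib(1) idem)

lemma d_idem: "x \<in> C \<Longrightarrow> d x x = x"
  by (simp add: d_def idem)

lemma d_neg: "x \<in> C \<Longrightarrow> y \<in> C \<Longrightarrow> \<sim>(d x y) = d (\<sim>x) (\<sim>y)"
  by (simp add: d_dual[of "\<sim>x" "\<sim>y"]) (simp add: d_def de_morgan)

lemma d_join_left: "x \<in> C \<Longrightarrow> y \<in> C \<Longrightarrow> z \<in> C \<Longrightarrow> d (x \<squnion> y) z = d x z \<squnion> d y z"
  by (simp add: d_dual distrib(1) distrib_right aci)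

lemma d_meet_left:
  assumes c: "x \<in> C" "y \<in> C" "z \<in> C"
  shows "d (x \<sqinter> y) z = d x z \<sqinter> d y z"
proof -
  have "x \<sqinter> y \<squnion> z = (x \<squnion> z) \<sqinter> (y \<squnion> z)"
    using c by (simp add: comm(2)[of _ z] distrib(2))
  moreover have "x \<sqinter> y \<sqinter> (u \<sqinter> v) = x \<sqinter> u \<sqinter> (y \<sqinter> v)" if "u \<in> C" "v \<in> C" for u v
    using c that by (simp add: assoc left_comm(1))
  ultimately show ?thesis using c by (simp add: d_def)
qed

text \<open>Expanded by \<open>d_dual\<close>, the right side has the extra joinand
  \<open>x \<sqinter> (y \<sqinter> z)\<close>, which must be produced on the left without
  absorption.\<close>

lemma d_join_right:
  assumes c: "x \<in> C" "y \<in> C" "z \<in> C"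
  shows "d x (y \<squnion> z) = d (d x y) z"
proof -
  \<comment> \<open>Expand the meet of \<open>p \<squnion> q\<close> with itself: the mixed terms
    contribute \<open>p \<sqinter> q\<close>.\<close>
  have "p \<squnion> q = (p \<squnion> q) \<squnion> p \<sqinter> q" if "p \<in> C" "q \<in> C" for p q
  proof -
    have "(p \<squnion> q) \<sqinter> (p \<squnion> q) = (p \<squnion> q) \<squnion> p \<sqinter> q"
      using that by (simp only: distrib(1) distrib_right closed) (simp add: aci)
    then show ?thesis using that by (simp add: idem)
  qed
  from this[of "x \<sqinter> y" "x \<sqinter> z"]
  have "x \<sqinter> y \<squnion> x \<sqinter> z = x \<sqinter> y \<squnion> (x \<sqinter> z \<squnion> x \<sqinter> (y \<sqinter> z))"
    using c by (simp add: aci)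
  then show ?thesis using c by (simp add: d_dual distrib(1) distrib_right aci)
qed

lemma d_meet_right:
  assumes c: "x \<in> C" "y \<in> C" "z \<in> C"
  shows "d x (y \<sqinter> z) = d (d x y) z"
proof -
  have "d x (y \<sqinter> z) = d x y \<sqinter> (x \<squnion> z)" using c by (simp add: d_def distrib(2) assoc)
  \<comment> \<open>\<open>d x y\<close> has \<open>x\<close> as a factor, so meeting it with
    \<open>x \<squnion> z\<close> gives \<open>d x y \<squnion> d x y \<sqinter> z\<close>.\<close>
  also have "\<dots> = d (d x y) z"
    using c by (simp add: d_dual distrib(1) distrib_right aci)
  finally show ?thesis .
qed

lemma d_right_comm: "x \<in> C \<Longrightarrow> y \<in> C \<Longrightarrow> z \<in> C \<Longrightarrow> d (d x y) z = d (d x z) y"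
  by (metis comm(2) d_join_right)

lemma d_right_idem: "x \<in> C \<Longrightarrow> y \<in> C \<Longrightarrow> d (d x y) y = d x y"
  by (metis idem(2) d_join_right)

text \<open>Unfolding \<open>d y z\<close> on the right makes \<open>y\<close> act twice, and right
  idempotency removes one of them. With idempotency and right commutativity, \<open>d\<close> is now
  the operation of a left normal band.\<close>

lemma d_assoc: "x \<in> C \<Longrightarrow> y \<in> C \<Longrightarrow> z \<in> C \<Longrightarrow> d x (d y z) = d (d x y) z"
  using d_meet_right[of x y "y \<squnion> z"] d_join_right[of "d x y" y z]
  by (simp add: d_def[of y z] d_right_idem)

section \<open>The quasi-order of the partition function and representatives of its classes\<close>

definition le :: "'a \<Rightarrow> 'a \<Rightarrow> bool" where
  "le x y \<longleftrightarrow> d y x = y"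

lemma le_refl: "x \<in> C \<Longrightarrow> le x x"
  by (simp add: le_def d_idem)

lemma le_trans: "x \<in> C \<Longrightarrow> y \<in> C \<Longrightarrow> z \<in> C \<Longrightarrow> le x y \<Longrightarrow> le y z \<Longrightarrow> le x z"
  by (metis le_def d_assoc)

text \<open>\<open>d z (x \<squnion> y)\<close> is \<open>d (d z x) y\<close>. If this equals
  \<open>z\<close>, then \<open>z\<close> absorbs both \<open>x\<close> and \<open>y\<close> by
  right commutativity and right idempotency. Joins are thus suprema for the quasi-order.\<close>

lemma le_join_iff: "x \<in> C \<Longrightarrow> y \<in> C \<Longrightarrow> z \<in> C \<Longrightarrow> le (x \<squnion> y) z \<longleftrightarrow> le x z \<and> le y z"
  unfolding le_def by (metis d_join_right d_right_comm d_right_idem d_closed)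

text \<open>\<open>d\<close> treats a meet and a join in its second argument alike; this is why the
  two operations coincide in the quotient.\<close>

lemma le_meet_iff: "x \<in> C \<Longrightarrow> y \<in> C \<Longrightarrow> z \<in> C \<Longrightarrow> le (x \<sqinter> y) z \<longleftrightarrow> le (x \<squnion> y) z"
  by (simp add: le_def d_meet_right d_join_right)

lemma le_d_iff: "x \<in> C \<Longrightarrow> y \<in> C \<Longrightarrow> z \<in> C \<Longrightarrow> le (d x y) z \<longleftrightarrow> le (x \<squnion> y) z"
  by (simp add: le_def d_assoc d_join_right)

lemma le_neg: "x \<in> C \<Longrightarrow> y \<in> C \<Longrightarrow> le x y \<Longrightarrow> le (\<sim>x) (\<sim>y)"
  by (metis le_def d_neg)

text \<open>Classes are encoded by chosen representatives, so that the index semilattice lives on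
  the type of \<open>A\<close>, as \<open>dmp_sums\<close> requires. Equivalent elements give the
  same choice predicate and hence the same representative.\<close>

definition r :: "'a \<Rightarrow> 'a" where
  "r x = (SOME y. y \<in> C \<and> le x y \<and> le y x)"

lemma r:
  assumes "x \<in> C"
  shows "r x \<in> C" "le x (r x)" "le (r x) x"
  using someI[of "\<lambda>y. y \<in> C \<and> le x y \<and> le y x" x] assms by (auto simp: r_def le_refl)

lemma r_eq_iff: "x \<in> C \<Longrightarrow> y \<in> C \<Longrightarrow> r x = r y \<longleftrightarrow> le x y \<and> le y x"
proof
  assume c: "x \<in> C" "y \<in> C" and "r x = r y"
  then show "le x y \<and> le y x" by (metis r le_trans)
next
  assume c: "x \<in> C" "y \<in> C" and "le x y \<and> le y x"
  then have "z \<in> C \<and> le x z \<and> le z x \<longleftrightarrow> z \<in> C \<and> le y z \<and> le z y" for z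
    by (metis le_trans)
  then show "r x = r y" by (simp add: r_def)
qed

text \<open>A class is determined by its upper bounds; computing representatives thereby reduces to
  the equivalences for \<open>le\<close>.\<close>

lemma r_eqI:
  assumes "x \<in> C" "y \<in> C" "\<And>z. z \<in> C \<Longrightarrow> le x z \<longleftrightarrow> le y z"
  shows "r x = r y"
  using assms by (simp add: r_eq_iff) (metis le_refl)

lemma le_r_left: "x \<in> C \<Longrightarrow> z \<in> C \<Longrightarrow> le (r x) z \<longleftrightarrow> le x z"
  by (metis r le_trans)

lemma r_r: "x \<in> C \<Longrightarrow> r (r x) = r x"
  by (simp add: r_eq_iff r)

lemma r_meet: "x \<in> C \<Longrightarrow> y \<in> C \<Longrightarrow> r (x \<sqinter> y) = r (x \<squnion> y)"
  by (intro r_eqI) (simp_all add: le_meet_iff)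

lemma r_d: "x \<in> C \<Longrightarrow> y \<in> C \<Longrightarrow> r (d x y) = r (x \<squnion> y)"
  by (intro r_eqI) (simp_all add: le_d_iff)

lemma r_join: "x \<in> C \<Longrightarrow> y \<in> C \<Longrightarrow> r (r x \<squnion> r y) = r (x \<squnion> y)"
  by (intro r_eqI) (simp_all add: r le_join_iff le_r_left)

lemma r_neg: "x \<in> C \<Longrightarrow> r (\<sim>(r x)) = r (\<sim>x)"
  by (simp add: r_eq_iff r le_neg)

text \<open>Equivalent elements absorb each other, and right commutativity lets either one be
  absorbed. Only the class of the second argument matters, so \<open>d a j\<close> can serve as the
  transition into the class of \<open>j\<close>.\<close>

lemma d_r: "x \<in> C \<Longrightarrow> y \<in> C \<Longrightarrow> d x (r y) = d x y"
proof -
  assume c: "x \<in> C" "y \<in> C"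
  have "d x (r y) = d x (d (r y) y)" using r(2)[OF c(2)] by (simp add: le_def)
  also have "\<dots> = d x (d y (r y))" using c r(1)[OF c(2)] by (simp add: d_assoc d_right_comm)
  also have "\<dots> = d x y" using r(3)[OF c(2)] by (simp add: le_def)
  finally show ?thesis .
qed

section \<open>The index semilattice and the fibres\<close>

definition index :: "'a alg" where
  "index = \<lparr>carrier = r ` C, meet = (\<lambda>x y. r (x \<squnion> y)), join = (\<lambda>x y. r (x \<squnion> y)),
     neg = (\<lambda>x. r (\<sim>x))\<rparr>"

definition cls :: "'a \<Rightarrow> 'a lat" where
  "cls i = \<lparr>carrier = {x \<in> C. r x = i}, meet = meet A, join = join A\<rparr>"

lemma alg_index: "algebra index"
  using alg_closed(1)[OF alg] by (auto simp: algebra_def lat_closed_def index_def r)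

lemma r_hom: "alg_hom r A index"
  by (intro alg_homI) (simp_all add: index_def r_meet r_join r_neg)

text \<open>\<open>r\<close> maps \<open>A\<close> onto \<open>index\<close>; the bipolar axiom will
  reach the index in this way.\<close>

lemma index_satisfies: "A \<Turnstile> e \<Longrightarrow> index \<Turnstile> e"
  by (rule satisfies_hom_image[OF alg r_hom]) (simp_all add: index_def)

lemma index_InvSL: "index \<in> InvSL"
proof -
  have ax: "\<forall>e\<in>dmbl_axioms. index \<Turnstile> e"
    using DMBL index_satisfies by (simp add: DMBL_def Mod_def)
  then have "index \<Turnstile> \<^bold>\<not>(\<^bold>x \<^bold>\<and> \<^bold>y) \<doteq> \<^bold>\<not>\<^bold>x \<^bold>\<or> \<^bold>\<not>\<^bold>y" by (simp add: dmbl_axioms_def)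
  \<comment> \<open>Meet and join coincide in \<open>index\<close>, so a De Morgan law becomes the
    join law of involutive semilattices.\<close>
  then have "index \<Turnstile> \<^bold>\<not>(\<^bold>x \<^bold>\<or> \<^bold>y) \<doteq> \<^bold>\<not>\<^bold>x \<^bold>\<or> \<^bold>\<not>\<^bold>y"
    by (simp add: satisfies_def index_def)
  moreover have "index \<Turnstile> \<^bold>x \<^bold>\<and> \<^bold>y \<doteq> \<^bold>x \<^bold>\<or> \<^bold>y" by (simp add: satisfies_def index_def)
  ultimately show ?thesis
    using ax alg_index by (simp add: InvSL_def Mod_def dmbl_axioms_def)
qed

lemma index_elem: "i \<in> carrier index \<Longrightarrow> i \<in> C \<and> r i = i"
  by (auto simp: index_def r r_r)

lemma isl_le_index: "isl_le index i j \<Longrightarrow> i \<in> C \<and> j \<in> C \<and> r i = i \<and> r j = j \<and> r (i \<squnion> j) = j"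
  using index_elem[of i] index_elem[of j] unfolding isl_le_def by (simp add: index_def)

text \<open>Within one class \<open>d x y\<close> is \<open>x\<close>, and the two forms of
  \<open>d\<close> turn this into the two absorption laws. Hence the classes are lattices.\<close>

lemma absorb:
  assumes "x \<in> C" "y \<in> C" "r x = r y"
  shows "x \<sqinter> (x \<squnion> y) = x" "x \<squnion> x \<sqinter> y = x"
  using assms by (simp_all add: r_eq_iff le_def flip: d_dual) (simp add: d_def)

lemma d_absorb: "x \<in> C \<Longrightarrow> y \<in> C \<Longrightarrow> r x = r y \<Longrightarrow> d x y = x"
  by (simp add: r_eq_iff le_def)

lemma r_binary:
  assumes "x \<in> C" "y \<in> C" "r (r x \<squnion> r y) = k"
  shows "r (x \<squnion> y) = k" "r (x \<sqinter> y) = k" "r (d x y) = k"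
  using assms r_join[of x y] by (simp_all add: r_meet r_d)

text \<open>Distributivity of \<open>d\<close> in its first argument makes the transitions
  homomorphisms, its behaviour in the second makes them compose, and \<open>d_neg\<close> makes them
  commute with negation.\<close>

lemma system: "dm_system index cls (\<lambda>i j a. d a j) (\<lambda>i. neg A)"
proof
  show "index \<in> InvSL" by (rule index_InvSL)
next
  fix i assume "i \<in> carrier index"
  then have i: "i \<in> C" "r i = i" using index_elem by auto
  have "r (i \<squnion> i) = i" using i by (simp add: idem)
  then have "lat_closed (cls i)"
    using i by (auto simp: lat_closed_def cls_def intro: r_binary)
  moreover have "x \<sqinter> y = y \<sqinter> x \<and> x \<squnion> y = y \<squnion> x \<and> x \<sqinter> y \<sqinter> z = x \<sqinter> (y \<sqinter> z) \<and>
      x \<squnion> y \<squnion> z = x \<squnion> (y \<squnion> z) \<and> x \<sqinter> (x \<squnion> y) = x \<and> x \<squnion> x \<sqinter> y = x \<and>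
      x \<sqinter> (y \<squnion> z) = x \<sqinter> y \<squnion> x \<sqinter> z"
    if "x \<in> carrier (cls i)" "y \<in> carrier (cls i)" "z \<in> carrier (cls i)" for x y z
    using that by (intro conjI; simp only: comm assoc absorb distrib(1) cls_def lat.simps mem_Collect_eq)
  ultimately show "distributive_lattice (cls i)"
    unfolding distributive_lattice_def by (simp only: cls_def lat.simps) blast
next
  fix i j :: 'a assume "i \<noteq> j"
  then show "carrier (cls i) \<inter> carrier (cls j) = {}" by (auto simp: cls_def)
next
  fix i j assume "isl_le index i j"
  from isl_le_index[OF this] show "lat_hom (\<lambda>a. d a j) (cls i) (cls j)"
    by (auto simp: lat_hom_def cls_def d_meet_left d_join_left intro: r_binary)
next
  fix i a assume "i \<in> carrier index" "a \<in> carrier (cls i)"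
  then show "d a i = a" by (auto simp: cls_def d_absorb dest!: index_elem)
next
  fix i j k a assume "isl_le index i j" "isl_le index j k" "a \<in> carrier (cls i)"
  then have "a \<in> C" "j \<in> C" "k \<in> C" "r (j \<squnion> k) = r k"
    by (auto simp: cls_def dest!: isl_le_index)
  \<comment> \<open>\<open>d (d a j) k\<close> is \<open>d a (j \<squnion> k)\<close>, and
    \<open>j \<squnion> k\<close> lies in the class of \<open>k\<close>.\<close>
  then show "d (d a j) k = d a k" by (metis d_join_right d_r closed(2))
next
  fix i assume "i \<in> carrier index"
  then have i: "i \<in> C" "r i = i" using index_elem by auto
  have "r (\<sim>x) = r (\<sim>i)" if "x \<in> C" "r x = i" for x
    using that r_neg[of x] by simp
  moreover have "r (\<sim>x) = i" if "x \<in> C" "r x = r (\<sim>i)" for x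
    using that i r_neg[of x] r_neg[of "\<sim>i"] by (simp add: neg_neg)
  ultimately show "bij_betw (neg A) (carrier (cls i)) (carrier (cls (neg index i)))"
    by (intro bij_betw_byWitness[where f' = "neg A"]) (auto simp: cls_def index_def neg_neg)
next
  fix i a b assume "a \<in> carrier (cls i)" "b \<in> carrier (cls i)"
  then show "\<sim>(meet (cls i) a b) = join (cls (neg index i)) (\<sim>a) (\<sim>b)"
    "\<sim>(join (cls i) a b) = meet (cls (neg index i)) (\<sim>a) (\<sim>b)"
    by (simp_all add: cls_def de_morgan)
next
  fix i a assume "a \<in> carrier (cls i)"
  then show "\<sim>(\<sim>a) = a" by (simp add: cls_def neg_neg)
next
  fix i j a assume "isl_le index i j" "a \<in> carrier (cls i)"
  then have "a \<in> C" "j \<in> C" using isl_le_index by (simp_all add: cls_def)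
  then show "\<sim>(d a j) = d (\<sim>a) (neg index j)"
    by (simp add: index_def d_neg d_r)
qed

text \<open>The classes partition the carrier, so the identity map is the isomorphism.\<close>

lemma isomorphic_sum: "A \<cong> dmp_sum index cls (\<lambda>i j a. d a j) (\<lambda>i. neg A)"
proof -
  interpret dm_system index cls "\<lambda>i j a. d a j" "\<lambda>i. neg A" by (rule system)
  let ?D = "dmp_sum index cls (\<lambda>i j a. d a j) (\<lambda>i. neg A)"
  have fib: "fibre_of index cls x = r x" if "x \<in> C" for x
    using that by (intro fibre_of_eq) (auto simp: index_def cls_def)
  have k: "join index (r x) (r y) = r (x \<squnion> y)" if "x \<in> C" "y \<in> C" for x y
    using that by (simp add: index_def r_join)
  have "alg_hom id A ?D"
  proof (rule alg_homI)
    fix x y assume c: "x \<in> C" "y \<in> C"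
    \<comment> \<open>The map \<open>d _ k\<close>, with \<open>k\<close> the class of the result,
      fixes the result; distributing it over the operands gives the operation of the sum.\<close>
    show "id (x \<sqinter> y) = meet ?D (id x) (id y)"
      using c by (simp add: dmp_sum_def fib k cls_def d_r d_absorb r_meet flip: d_meet_left)
    show "id (x \<squnion> y) = join ?D (id x) (id y)"
      using c by (simp add: dmp_sum_def fib k cls_def d_r d_absorb flip: d_join_left)
  qed (auto simp: dmp_sum_def cls_def index_def)
  moreover have "carrier ?D = C" by (auto simp: dmp_sum_def cls_def index_def)
  ultimately show ?thesis unfolding isomorphic_def by (metis bij_betw_id)
qed

end


section \<open>Involutive semilattices in the variety generated by \<open>IS2\<close> and \<open>IS3\<close>\<close>

text \<open>Both operations return \<open>EI\<close> only on two arguments \<open>EI\<close>. Only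
  the set of variables matters, so regular identities hold in \<open>IS2\<close>.\<close>

lemma IS2_eval: "eval IS2 v t = EI \<longleftrightarrow> (\<forall>u\<in>vars t. v u = EI)"
  by (induction t) (auto simp: IS2_def)

text \<open>A binary operation returns a value \<open>c\<close> other than \<open>EJ\<close> only on
  two arguments \<open>c\<close>, while each negation exchanges \<open>c\<close> and
  \<open>neg IS3 c\<close>; polarity counts these exchanges modulo 2.\<close>

lemma IS3_eval:
  assumes "c \<noteq> EJ"
  shows "eval IS3 v t = c \<longleftrightarrow> (\<forall>u\<in>occ True t. v u = c) \<and> (\<forall>u\<in>occ False t. v u = neg IS3 c)"
  using assms
proof (induction t arbitrary: c)
  case (Neg t)
  have neg: "neg IS3 (neg IS3 a) = a" for a by (simp add: IS3_def)
  have "eval IS3 v (\<^bold>\<not>t) = c \<longleftrightarrow> eval IS3 v t = neg IS3 c"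
    using neg by (metis eval.simps(4))
  moreover have "neg IS3 c \<noteq> EJ" using Neg.prems by (simp add: IS3_def)
  ultimately show ?case using Neg.IH[of "neg IS3 c"] by (simp only: neg occ.simps simp_thms) blast
next
  case (Conj s t)
  have "eval IS3 v (s \<^bold>\<and> t) = c \<longleftrightarrow> eval IS3 v s = c \<and> eval IS3 v t = c"
    using Conj.prems by (auto simp: IS3_def)
  then show ?case using Conj.IH[OF Conj.prems] by (simp only: occ.simps) blast
next
  case (Disj s t)
  have "eval IS3 v (s \<^bold>\<or> t) = c \<longleftrightarrow> eval IS3 v s = c \<and> eval IS3 v t = c"
    using Disj.prems by (auto simp: IS3_def)
  then show ?case using Disj.IH[OF Disj.prems] by (simp only: occ.simps) blast
qed simp

lemma IS_satisfies_rbb: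
  assumes "regular_bipolarly_balanced e"
  shows "IS2 \<Turnstile> e" "IS3 \<Turnstile> e"
proof -
  obtain s t where e: "e = (s, t)" by (cases e)
  note rbb = assms[unfolded e]
  show "IS2 \<Turnstile> e"
    unfolding satisfies_def e
  proof (intro allI impI)
    fix v :: "nat \<Rightarrow> elt" assume v: "range v \<subseteq> carrier IS2"
    have "eval IS2 v t = EI \<or> eval IS2 v t = EJ" for t
      using eval_closed[OF algebra_DM4_IS2_IS3(2) v, of t] by (simp add: IS2_def)
    moreover have "eval IS2 v s = EI \<longleftrightarrow> eval IS2 v t = EI"
      by (simp add: IS2_eval rbb_vars[OF rbb])
    ultimately show "eval IS2 v (fst (s, t)) = eval IS2 v (snd (s, t))" by (metis fst_conv snd_conv)
  qed
  show "IS3 \<Turnstile> e"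
    unfolding satisfies_def e
  proof (intro allI impI)
    fix v :: "nat \<Rightarrow> elt" assume v: "range v \<subseteq> carrier IS3"
    \<comment> \<open>A variable of both polarities forces any value other than \<open>EJ\<close> to
      be fixed by negation, but neither \<open>EI\<close> nor \<open>ENI\<close> is.\<close>
    have bipolar: "eval IS3 v r = EJ" if both: "occ True r \<inter> occ False r \<noteq> {}" for r
    proof (rule ccontr)
      assume ne: "eval IS3 v r \<noteq> EJ"
      obtain u where "u \<in> occ True r" "u \<in> occ False r" using both by blast
      then have "neg IS3 (eval IS3 v r) = eval IS3 v r"
        using IS3_eval[OF ne, of v r] by auto
      moreover have "eval IS3 v r \<in> {EI, ENI}"
        using ne eval_closed[OF algebra_DM4_IS2_IS3(3) v, of r] by (simp add: IS3_def)
      ultimately show False by (auto simp: IS3_def)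
    qed
    from rbb show "eval IS3 v (fst (s, t)) = eval IS3 v (snd (s, t))"
    proof (cases rule: rbb_cases)
      case 1
      \<comment> \<open>The two sides agree on every value other than \<open>EJ\<close>, hence also
        on \<open>EJ\<close>.\<close>
      then have "eval IS3 v s = c \<longleftrightarrow> eval IS3 v t = c" if "c \<noteq> EJ" for c
        by (simp only: 1 IS3_eval[OF that])
      then show ?thesis by (metis fst_conv snd_conv)
    qed (simp add: bipolar)
  qed
qed

section \<open>Involutive semilattices with the bipolar axiom\<close>

abbreviation "bipolar_axiom \<equiv>
  \<^bold>x \<^bold>\<and> (\<^bold>x \<^bold>\<or> \<^bold>\<not>\<^bold>x) \<^bold>\<and> (\<^bold>x \<^bold>\<or> \<^bold>\<not>\<^bold>x \<^bold>\<or> \<^bold>y) \<doteq> \<^bold>x \<^bold>\<and> (\<^bold>x \<^bold>\<or> \<^bold>\<not>\<^bold>x) \<^bold>\<and> (\<^bold>x \<^bold>\<or> \<^bold>\<not>\<^bold>x \<^bold>\<or> \<^bold>\<not>\<^bold>y)"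

lemma
  assumes "S \<in> InvSL" and i: "i \<in> carrier S"
  shows InvSL_neg_neg: "neg S (neg S i) = i"
    and InvSL_meet: "j \<in> carrier S \<Longrightarrow> meet S i j = join S i j"
proof -
  have ax: "S \<Turnstile> \<^bold>\<not>(\<^bold>\<not>\<^bold>x) \<doteq> \<^bold>x" "S \<Turnstile> \<^bold>x \<^bold>\<and> \<^bold>y \<doteq> \<^bold>x \<^bold>\<or> \<^bold>y"
    using assms(1) by (simp_all add: InvSL_def Mod_def)
  note inst = ax[THEN satisfies_instance, OF i, simplified]
  show "neg S (neg S i) = i" by (fact inst(1)[OF i i])
  show "j \<in> carrier S \<Longrightarrow> meet S i j = join S i j" by (fact inst(2)[OF _ i])
qed

locale bipolar_semilattice =
  fixes S :: "'i alg"
  assumes InvSL: "S \<in> InvSL" and bipolar_axiom: "S \<Turnstile> bipolar_axiom"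
begin

lemma alg: "algebra S"
  using InvSL by (simp add: InvSL_def Mod_def)

lemmas closed = alg_closed[OF alg]
lemmas semilattice = InvSL_D[OF InvSL]
lemmas neg_neg = InvSL_neg_neg[OF InvSL]
lemmas meet = InvSL_meet[OF InvSL]

definition below :: "'i \<Rightarrow> 'i \<Rightarrow> bool" where
  "below i j \<longleftrightarrow> join S i j = j"

lemma below_join_iff:
  assumes "i \<in> carrier S" "j \<in> carrier S" "k \<in> carrier S"
  shows "below (join S i j) k \<longleftrightarrow> below i k \<and> below j k"
  using assms unfolding below_def by (metis semilattice(1,2,3) closed(3))

lemma below_neg_iff:
  assumes "i \<in> carrier S" "j \<in> carrier S"
  shows "below (neg S i) j \<longleftrightarrow> below i (neg S j)"
  using assms unfolding below_def by (metis semilattice(4) neg_neg closed(4))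

text \<open>With meet and join equal, the axiom says that \<open>?u\<close> has the same join with
  \<open>j\<close> and with \<open>neg S j\<close>. Since \<open>?u\<close> is below both, these
  joins are \<open>j\<close> and \<open>neg S j\<close> themselves.\<close>

lemma neg_fixed:
  assumes i: "i \<in> carrier S" and j: "j \<in> carrier S" "below i j" "below i (neg S j)"
  shows "neg S j = j"
proof -
  let ?u = "join S i (neg S i)"
  have u: "?u \<in> carrier S" "neg S j \<in> carrier S" "neg S i \<in> carrier S"
    using i j(1) by (simp_all add: closed)
  have "below (neg S i) j" "below (neg S i) (neg S j)"
    using i j u by (simp_all add: below_neg_iff neg_neg)
  then have le: "join S ?u j = j" "join S ?u (neg S j) = neg S j"
    using below_join_iff[of i "neg S i"] i j u by (simp_all add: below_def)
  have "join S (join S i ?u) (join S ?u j) = join S (join S i ?u) (join S ?u (neg S j))"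
    using satisfies_instance[OF bipolar_axiom i j(1) j(1)] i j(1) u by (simp add: meet closed)
  then have "join S ?u j = join S ?u (neg S j)"
    using i j(1) u by (metis semilattice(1,3) closed(3))
  then show ?thesis using le by simp
qed

text \<open>The elements sent to \<open>EI\<close> form the principal down-set of \<open>i\<close>.
  If negation fixes \<open>i\<close>, this set is closed under negation and \<open>IS2\<close>
  serves; otherwise its image under negation is the down-set of \<open>neg S i\<close>, and
  \<open>IS3\<close> serves.\<close>

lemma hom_IS:
  assumes i: "i \<in> carrier S"
  obtains h B where "B \<in> {IS2, IS3}" "alg_hom h S B" "\<And>j. h j = EI \<longleftrightarrow> below j i"
proof (cases "neg S i = i")
  case True
  let ?h = "\<lambda>j. if below j i then EI else EJ"
  have "alg_hom ?h S IS2"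
    using True i by (intro alg_homI) (simp_all add: IS2_def meet below_join_iff below_neg_iff)
  then show ?thesis by (intro that[of IS2 ?h]) simp_all
next
  case False
  let ?h = "\<lambda>j. if below j i then EI else if below j (neg S i) then ENI else EJ"
  \<comment> \<open>By \<open>neg_fixed\<close>, an element below both \<open>i\<close> and
    \<open>neg S i\<close> would make \<open>i\<close> fixed; so the two down-sets are
    disjoint.\<close>
  have excl: "\<not> (below j i \<and> below j (neg S i))" if "j \<in> carrier S" for j
    using neg_fixed[OF that i] False by blast
  have "alg_hom ?h S IS3"
    using i excl
    by (intro alg_homI) (auto simp: IS3_def meet below_join_iff below_neg_iff neg_neg closed)
  then show ?thesis by (intro that[of IS3 ?h]) simp_all
qed

lemma in_variety: "S \<in> generated_variety {IS2, IS3}"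
proof -
  have "S \<Turnstile> e" if e: "e \<in> Idt {IS2, IS3}" for e
    unfolding satisfies_def
  proof (intro allI impI)
    fix v :: "nat \<Rightarrow> 'i" assume v: "range v \<subseteq> carrier S"
    let ?a = "eval S v (fst e)" and ?b = "eval S v (snd e)"
    note cl = eval_closed[OF alg v]
    have iff: "below ?a i \<longleftrightarrow> below ?b i" if i: "i \<in> carrier S" for i
    proof -
      obtain h B where h: "B \<in> {IS2, IS3}" "alg_hom h S B" "\<And>j. h j = EI \<longleftrightarrow> below j i"
        by (rule hom_IS[OF i]) (rule that)
      have "range (\<lambda>u. h (v u)) \<subseteq> carrier B" using v alg_homD(1)[OF h(2)] by auto
      moreover have "B \<Turnstile> e" using e h(1) by (auto simp: Idt_def)
      ultimately have "h ?a = h ?b" unfolding hom_eval[OF alg h(2) v] satisfies_def by blast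
      then show ?thesis using h(3) by metis
    qed
    \<comment> \<open>Taking \<open>i\<close> to be each of the two sides puts each below the
      other.\<close>
    show "?a = ?b"
      using iff[OF cl] cl semilattice(1,2) unfolding below_def by metis
  qed
  then show ?thesis
    using alg algebra_DM4_IS2_IS3 by (simp add: generated_variety_eq Mod_def)
qed

end

lemma RBDMBL_subset_dmp_sums: "(RBDMBL :: 'a alg set) \<subseteq> dmp_sums (generated_variety {IS2, IS3})"
proof
  fix A :: "'a alg" assume "A \<in> RBDMBL"
  then have A: "A \<in> DMBL" "A \<Turnstile> bipolar_axiom" by (simp_all add: RBDMBL_def Mod_def)
  interpret de_morgan_bisemilattice A by standard (rule A)
  interpret S: bipolar_semilattice index
    using index_InvSL index_satisfies[OF A(2)] by unfold_locales
  show "A \<in> dmp_sums (generated_variety {IS2, IS3})"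
    unfolding dmp_sums_def using alg S.in_variety system isomorphic_sum by blast
qed


section \<open>De Morgan lattices\<close>

locale de_morgan_lattice =
  fixes A :: "'a alg"
  assumes DML: "A \<in> DML"
begin

sublocale de_morgan_bisemilattice A
  using DML by unfold_locales (simp add: DML_def DMBL_def Mod_def)

lemma absorption:
  assumes "x \<in> C" "y \<in> C"
  shows "x \<sqinter> (x \<squnion> y) = x" "x \<squnion> x \<sqinter> y = x"
proof -
  have ax: "A \<Turnstile> \<^bold>x \<^bold>\<and> (\<^bold>x \<^bold>\<or> \<^bold>y) \<doteq> \<^bold>x" "A \<Turnstile> \<^bold>x \<^bold>\<or> (\<^bold>x \<^bold>\<and> \<^bold>y) \<doteq> \<^bold>x"
    using DML by (simp_all add: DML_def Mod_def)
  note inst = ax[THEN satisfies_instance, OF assms(1), simplified]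
  show "x \<sqinter> (x \<squnion> y) = x" "x \<squnion> x \<sqinter> y = x"
    by (fact inst(1)[OF assms(2,1)] inst(2)[OF assms(2,1)])+
qed

text \<open>Both sides collapse to \<open>x\<close> by absorption.\<close>

lemma satisfies_bipolar_axiom: "A \<Turnstile> bipolar_axiom"
  by (simp add: satisfies_def image_subset_iff absorption assoc(2))

definition lq :: "'a \<Rightarrow> 'a \<Rightarrow> bool"  (infix "\<sqsubseteq>" 50) where
  "x \<sqsubseteq> y \<longleftrightarrow> x \<sqinter> y = x"

lemma lq_refl: "x \<in> C \<Longrightarrow> x \<sqsubseteq> x"
  by (simp add: lq_def idem)

lemma lq_trans:
  assumes "x \<in> C" "y \<in> C" "z \<in> C" "x \<sqsubseteq> y" "y \<sqsubseteq> z"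
  shows "x \<sqsubseteq> z"
  using assms unfolding lq_def by (metis assoc(1))

lemma lq_meet:
  assumes "x \<in> C" "y \<in> C"
  shows "x \<sqinter> y \<sqsubseteq> x" "x \<sqinter> y \<sqsubseteq> y"
  using assms unfolding lq_def by (metis assoc(1) comm(1) idem(1))+

lemma lq_join:
  assumes "x \<in> C" "y \<in> C"
  shows "x \<sqsubseteq> x \<squnion> y" "y \<sqsubseteq> x \<squnion> y"
  using assms unfolding lq_def by (metis absorption(1) comm(2))+

lemma meet_greatest: "x \<in> C \<Longrightarrow> y \<in> C \<Longrightarrow> z \<in> C \<Longrightarrow> z \<sqsubseteq> x \<Longrightarrow> z \<sqsubseteq> y \<Longrightarrow> z \<sqsubseteq> x \<sqinter> y"
  unfolding lq_def by (metis assoc(1))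

lemma join_least: "x \<in> C \<Longrightarrow> y \<in> C \<Longrightarrow> z \<in> C \<Longrightarrow> x \<sqsubseteq> z \<Longrightarrow> y \<sqsubseteq> z \<Longrightarrow> x \<squnion> y \<sqsubseteq> z"
  by (simp add: lq_def distrib_right)

lemma lq_antisym: "x \<in> C \<Longrightarrow> y \<in> C \<Longrightarrow> x \<sqsubseteq> y \<Longrightarrow> y \<sqsubseteq> x \<Longrightarrow> x = y"
  unfolding lq_def by (metis comm(1))

lemma meet_mono_left:
  assumes "x \<in> C" "y \<in> C" "z \<in> C" "x \<sqsubseteq> y"
  shows "x \<sqinter> z \<sqsubseteq> y \<sqinter> z"
  using assms by (intro meet_greatest) (auto intro: lq_trans[OF _ _ _ lq_meet(1)] lq_meet)

section \<open>Prime filters and homomorphisms into \<open>DM4\<close>\<close>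

definition lattice_filter :: "'a set \<Rightarrow> bool" where
  "lattice_filter G \<longleftrightarrow> G \<subseteq> C \<and> (\<forall>x\<in>G. \<forall>y\<in>G. x \<sqinter> y \<in> G) \<and> (\<forall>x\<in>G. \<forall>y\<in>C. x \<sqsubseteq> y \<longrightarrow> y \<in> G)"

text \<open>For nonempty \<open>P\<close>, \<open>G\<close> is the filter generated by
  \<open>P\<close> and \<open>x\<close>. The empty set counts as a filter, hence the condition on
  \<open>P\<close> in the last claim.\<close>

lemma filter_extension:
  assumes P: "lattice_filter P" and x: "x \<in> C"
  defines "G \<equiv> {z \<in> C. \<exists>q\<in>P. q \<sqinter> x \<sqsubseteq> z}"
  shows "lattice_filter G" "P \<subseteq> G" "P \<noteq> {} \<Longrightarrow> x \<in> G"
proof -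
  have PC: "q \<in> C" if "q \<in> P" for q using P that by (auto simp: lattice_filter_def)
  show "P \<subseteq> G" using PC x lq_meet by (auto simp: G_def)
  show "P \<noteq> {} \<Longrightarrow> x \<in> G" using PC x lq_meet by (auto simp: G_def)
  show "lattice_filter G"
    unfolding lattice_filter_def
  proof (intro conjI ballI impI)
    fix z z' assume "z \<in> G" "z' \<in> G"
    then obtain q q' where q: "q \<in> P" "q \<sqinter> x \<sqsubseteq> z" "q' \<in> P" "q' \<sqinter> x \<sqsubseteq> z'" and z: "z \<in> C" "z' \<in> C"
      by (auto simp: G_def)
    note c = PC[OF q(1)] PC[OF q(3)]
    have "q \<sqinter> q' \<sqinter> x \<sqsubseteq> z" "q \<sqinter> q' \<sqinter> x \<sqsubseteq> z'"
      using lq_trans[OF _ _ _ meet_mono_left q(2)] lq_trans[OF _ _ _ meet_mono_left q(4)]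
      by (simp_all add: c z x lq_meet)
    then have "q \<sqinter> q' \<sqinter> x \<sqsubseteq> z \<sqinter> z'" using c z x by (intro meet_greatest) auto
    moreover have "q \<sqinter> q' \<in> P" using P q by (simp add: lattice_filter_def)
    ultimately show "z \<sqinter> z' \<in> G" using z by (auto simp: G_def)
  next
    fix z y assume "z \<in> G" "y \<in> C" "z \<sqsubseteq> y"
    then show "y \<in> G" using PC x by (auto simp: G_def intro: lq_trans)
  qed (auto simp: G_def)
qed

text \<open>Zorn's lemma gives a filter maximal among those containing \<open>a\<close> and omitting
  \<open>b\<close>; distributivity makes it prime.\<close>

lemma prime_filter:
  assumes a: "a \<in> C" and b: "b \<in> C" and ab: "\<not> a \<sqsubseteq> b"
  obtains P where "lattice_filter P" "a \<in> P" "b \<notin> P"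
    "\<And>x y. x \<in> C \<Longrightarrow> y \<in> C \<Longrightarrow> x \<squnion> y \<in> P \<Longrightarrow> x \<in> P \<or> y \<in> P"
proof -
  define \<F> where "\<F> = {G. lattice_filter G \<and> a \<in> G \<and> b \<notin> G}"
  \<comment> \<open>The principal filter of \<open>a\<close> starts the Zorn argument.\<close>
  have "{x \<in> C. a \<sqsubseteq> x} \<in> \<F>"
    using a ab by (auto simp: \<F>_def lattice_filter_def lq_refl intro: meet_greatest lq_trans)
  then have "\<F> \<noteq> {}" by blast
  moreover have "\<Union>\<C> \<in> \<F>" if "\<C> \<noteq> {}" "subset.chain \<F> \<C>" for \<C>
  proof -
    have sub: "lattice_filter G" "a \<in> G" "b \<notin> G" if "G \<in> \<C>" for G
      using that \<open>subset.chain \<F> \<C>\<close> by (auto simp: \<F>_def subset.chain_def)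
    \<comment> \<open>Two members of the chain are comparable, so \<open>x\<close> and
      \<open>y\<close> already lie in a common one.\<close>
    have meet: "x \<sqinter> y \<in> \<Union>\<C>" if xy: "x \<in> G" "y \<in> H" "G \<in> \<C>" "H \<in> \<C>" for x y G H
    proof -
      have "G \<subseteq> H \<or> H \<subseteq> G" using xy \<open>subset.chain \<F> \<C>\<close> by (auto simp: subset.chain_def)
      then obtain K where "K \<in> \<C>" "x \<in> K" "y \<in> K" using xy by blast
      then show ?thesis using sub(1)[of K] by (auto simp: lattice_filter_def)
    qed
    have up: "y \<in> \<Union>\<C>" if "x \<in> G" "G \<in> \<C>" "y \<in> C" "x \<sqsubseteq> y" for x y G
      using that sub(1)[OF that(2)] unfolding lattice_filter_def by blast
    have "G \<subseteq> C" if "G \<in> \<C>" for G using sub(1)[OF that] by (simp add: lattice_filter_def)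
    then have "\<Union>\<C> \<subseteq> C" by (rule Union_least)
    moreover have "x \<sqinter> y \<in> \<Union>\<C>" if "x \<in> \<Union>\<C>" "y \<in> \<Union>\<C>" for x y
      using that by (elim UnionE) (rule meet)
    moreover have "y \<in> \<Union>\<C>" if "x \<in> \<Union>\<C>" "y \<in> C" "x \<sqsubseteq> y" for x y
      using that by (elim UnionE) (rule up)
    ultimately have "lattice_filter (\<Union>\<C>)" unfolding lattice_filter_def by simp
    then show ?thesis using sub(2,3) \<open>\<C> \<noteq> {}\<close> by (auto simp: \<F>_def)
  qed
  ultimately obtain P where P: "P \<in> \<F>" and max: "\<And>G. G \<in> \<F> \<Longrightarrow> P \<subseteq> G \<Longrightarrow> G = P"
    using subset_Zorn_nonempty[of \<F>] by blast
  have filter: "lattice_filter P" "a \<in> P" "b \<notin> P" using P by (auto simp: \<F>_def)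
  have PC: "q \<in> C" if "q \<in> P" for q using filter(1) that by (auto simp: lattice_filter_def)
  \<comment> \<open>By maximality, adjoining an element outside \<open>P\<close> must bring
    \<open>b\<close> into the generated filter.\<close>
  have ext: "\<exists>q\<in>P. q \<sqinter> x \<sqsubseteq> b" if x: "x \<in> C" "x \<notin> P" for x
  proof (rule ccontr)
    assume "\<not> ?thesis"
    then have "{z \<in> C. \<exists>q\<in>P. q \<sqinter> x \<sqsubseteq> z} \<in> \<F>"
      using filter_extension[OF filter(1) x(1)] filter(2) by (auto simp: \<F>_def)
    then show False using max filter_extension(2,3)[OF filter(1) x(1)] filter(2) x(2) by blast
  qed
  show ?thesis
  proof (rule that[OF filter], rule ccontr)
    fix x y assume xy: "x \<in> C" "y \<in> C" "x \<squnion> y \<in> P" "\<not> (x \<in> P \<or> y \<in> P)"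
    then obtain q q' where q: "q \<in> P" "q \<sqinter> x \<sqsubseteq> b" "q' \<in> P" "q' \<sqinter> y \<sqsubseteq> b" using ext by meson
    note c = PC[OF q(1)] PC[OF q(3)]
    \<comment> \<open>The common factor \<open>q \<sqinter> q'\<close> serves both elements, so
      distributivity puts a member of \<open>P\<close> below \<open>b\<close>.\<close>
    have "q \<sqinter> q' \<sqinter> x \<sqsubseteq> b" "q \<sqinter> q' \<sqinter> y \<sqsubseteq> b"
      using lq_trans[OF _ _ _ meet_mono_left q(2)] lq_trans[OF _ _ _ meet_mono_left q(4)]
      by (simp_all add: c b xy lq_meet)
    then have "q \<sqinter> q' \<sqinter> (x \<squnion> y) \<sqsubseteq> b" using c b xy by (simp add: distrib(1) join_least)
    moreover have "q \<sqinter> q' \<sqinter> (x \<squnion> y) \<in> P"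
      using filter(1) q xy(3) by (simp add: lattice_filter_def)
    ultimately show False using filter(1,3) b by (auto simp: lattice_filter_def)
  qed
qed

lemma satisfies_if_DM4:
  assumes "DM4 \<Turnstile> e"
  shows "A \<Turnstile> e"
  unfolding satisfies_def
proof (intro allI impI)
  fix v :: "nat \<Rightarrow> 'a" assume v: "range v \<subseteq> C"
  let ?a = "eval A v (fst e)" and ?b = "eval A v (snd e)"
  note cl = eval_closed[OF alg v]
  \<comment> \<open>Stated for the unordered pair of values, so that it yields both
    inequalities.\<close>
  have iff: "a \<sqsubseteq> b" if ab: "{a, b} = {?a, ?b}" for a b
  proof (rule ccontr)
    assume nle: "\<not> a \<sqsubseteq> b"
    have c: "a \<in> C" "b \<in> C" using ab cl by (metis insertCI insertE singletonD)+
    obtain P where P: "lattice_filter P" "a \<in> P" "b \<notin> P"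
      and prime: "\<And>x y. x \<in> C \<Longrightarrow> y \<in> C \<Longrightarrow> x \<squnion> y \<in> P \<Longrightarrow> x \<in> P \<or> y \<in> P"
      by (rule prime_filter[OF c nle]) (rule that)
    \<comment> \<open>The four values record which of \<open>x\<close> and \<open>\<sim>x\<close>
      lie in \<open>P\<close>: both, only \<open>x\<close>, only \<open>\<sim>x\<close>, or neither.
      Thus \<open>h\<close> separates \<open>a\<close> from \<open>b\<close>.\<close>
    define h where "h x = (if x \<in> P then if \<sim>x \<in> P then Top else TT
       else if \<sim>x \<in> P then FF else Bot)" for x
    have up: "y \<in> P" if "x \<in> P" "y \<in> C" "x \<sqsubseteq> y" for x y
      using P(1) that by (auto simp: lattice_filter_def)
    have meet: "x \<sqinter> y \<in> P \<longleftrightarrow> x \<in> P \<and> y \<in> P" if "x \<in> C" "y \<in> C" for x y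
      using P(1) up[of "x \<sqinter> y"] lq_meet[OF that] that by (auto simp: lattice_filter_def)
    have join: "x \<squnion> y \<in> P \<longleftrightarrow> x \<in> P \<or> y \<in> P" if "x \<in> C" "y \<in> C" for x y
      using prime[OF that] up[of _ "x \<squnion> y"] lq_join[OF that] that by auto
    have h: "alg_hom h A DM4"
      by (rule alg_homI) (simp_all add: h_def DM4_def meet join de_morgan neg_neg)
    have "range (\<lambda>u. h (v u)) \<subseteq> carrier DM4" using v alg_homD(1)[OF h] by auto
    then have "h ?a = h ?b" using assms unfolding hom_eval[OF alg h v] satisfies_def by blast
    then have "h a = h b" using ab by (metis insertCI insertE singletonD)
    then show False using P(2,3) by (simp add: h_def split: if_splits)
  qed
  show "?a = ?b" using cl by (intro lq_antisym iff) auto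
qed

end

section \<open>Elementwise laws of De Morgan and distributive lattices\<close>

lemma DMLI:
  assumes "algebra A"
    and "\<And>x y z. x \<in> carrier A \<Longrightarrow> y \<in> carrier A \<Longrightarrow> z \<in> carrier A \<Longrightarrow>
      meet A x x = x \<and> meet A x y = meet A y x \<and> meet A (meet A x y) z = meet A x (meet A y z) \<and>
      join A x x = x \<and> join A x y = join A y x \<and> join A (join A x y) z = join A x (join A y z) \<and>
      meet A x (join A y z) = join A (meet A x y) (meet A x z) \<and>
      join A x (meet A y z) = meet A (join A x y) (join A x z) \<and>
      meet A x (join A x y) = x \<and> join A x (meet A x y) = x \<and>
      neg A (neg A x) = x \<and> neg A (meet A x y) = join A (neg A x) (neg A y) \<and>
      neg A (join A x y) = meet A (neg A x) (neg A y)"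
  shows "A \<in> DML"
proof -
  have "A \<Turnstile> e" if "e \<in> dmbl_axioms \<union> {\<^bold>x \<^bold>\<and> (\<^bold>x \<^bold>\<or> \<^bold>y) \<doteq> \<^bold>x, \<^bold>x \<^bold>\<or> (\<^bold>x \<^bold>\<and> \<^bold>y) \<doteq> \<^bold>x}" for e
    unfolding satisfies_def
  proof (intro allI impI)
    fix v :: "nat \<Rightarrow> 'a" assume "range v \<subseteq> carrier A"
    then have "v 0 \<in> carrier A" "v 1 \<in> carrier A" "v 2 \<in> carrier A" by auto
    from assms(2)[OF this] that show "eval A v (fst e) = eval A v (snd e)"
      unfolding dmbl_axioms_def by (elim UnE insertE emptyE conjE)
        (simp_all only: eval.simps fst_conv snd_conv)
  qed
  then show ?thesis using assms(1) by (simp add: DML_def Mod_def)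
qed

lemma DM4_in_DML: "DM4 \<in> DML"
  by (rule DMLI[OF algebra_DM4_IS2_IS3(1)], unfold DM4_def alg.simps lat.simps)
    (elim insertE emptyE; simp only:; simp)

text \<open>Idempotency and the second distributive law are derived from absorption and the first
  distributive law; \<open>DMLI\<close> asks for them.\<close>

lemma distributive_latticeD:
  assumes "distributive_lattice L" "x \<in> carrier L" "y \<in> carrier L"
  shows "meet L x y \<in> carrier L" "join L x y \<in> carrier L"
    "meet L x y = meet L y x" "join L x y = join L y x"
    "meet L x (join L x y) = x" "join L x (meet L x y) = x"
    "meet L x x = x" "join L x x = x"
    "z \<in> carrier L \<Longrightarrow> meet L (meet L x y) z = meet L x (meet L y z)"
    "z \<in> carrier L \<Longrightarrow> join L (join L x y) z = join L x (join L y z)"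
    "z \<in> carrier L \<Longrightarrow> meet L x (join L y z) = join L (meet L x y) (meet L x z)"
    "z \<in> carrier L \<Longrightarrow> join L x (meet L y z) = meet L (join L x y) (join L x z)"
proof -
  have cl: "meet L x y \<in> carrier L \<and> join L x y \<in> carrier L" if "x \<in> carrier L" "y \<in> carrier L" for x y
    using assms(1) that by (simp add: distributive_lattice_def lat_closed_def)
  have laws: "meet L x y = meet L y x \<and> join L x y = join L y x \<and>
       meet L (meet L x y) z = meet L x (meet L y z) \<and>
       join L (join L x y) z = join L x (join L y z) \<and>
       meet L x (join L x y) = x \<and> join L x (meet L x y) = x \<and>
       meet L x (join L y z) = join L (meet L x y) (meet L x z)"
    if "x \<in> carrier L" "y \<in> carrier L" "z \<in> carrier L" for x y z
    using assms(1) that unfolding distributive_lattice_def by blast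
  show "meet L x y \<in> carrier L" "join L x y \<in> carrier L" using cl[OF assms(2,3)] by auto
  show "meet L x y = meet L y x" "join L x y = join L y x"
    "meet L x (join L x y) = x" "join L x (meet L x y) = x"
    using laws[OF assms(2,3,3)] by auto
  have absorb: "meet L x (join L x y) = x" "join L x (meet L x y) = x"
    if "x \<in> carrier L" "y \<in> carrier L" for x y
    using laws[OF that that(2)] by blast+
  \<comment> \<open>Substituting one absorption law into the other leaves
    \<open>meet L x x = x\<close>, and dually.\<close>
  have "meet L x (join L x (meet L x x)) = x" "join L x (meet L x x) = x"
      "join L x (meet L x (join L x x)) = x" "meet L x (join L x x) = x"
    by (rule absorb assms cl[THEN conjunct1] cl[THEN conjunct2])+
  then show "meet L x x = x" "join L x x = x" by simp_all
  assume z: "z \<in> carrier L"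
  show "meet L (meet L x y) z = meet L x (meet L y z)" "join L (join L x y) z = join L x (join L y z)"
    "meet L x (join L y z) = join L (meet L x y) (meet L x z)"
    using laws[OF assms(2,3) z] by auto
  let ?u = "join L x y"
  have u: "?u \<in> carrier L" and zx: "meet L z x \<in> carrier L" "meet L z y \<in> carrier L"
    using cl assms z by auto
  have comm: "meet L x y = meet L y x" if "x \<in> carrier L" "y \<in> carrier L" for x y
    using laws[OF that that(2)] by blast
  have dist: "meet L x (join L y z) = join L (meet L x y) (meet L x z)"
      "join L (join L x y) z = join L x (join L y z)"
    if "x \<in> carrier L" "y \<in> carrier L" "z \<in> carrier L" for x y z
    using laws[OF that] by blast+
  have "join L x (meet L y z) = join L (join L x (meet L x z)) (meet L z y)"
    by (simp only: absorb assms z comm[of y z])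
  also have "\<dots> = join L x (meet L z ?u)"
    using zx by (simp only: dist assms z comm[of x z])
  \<comment> \<open>Absorption rewrites \<open>x\<close> as its meet with \<open>?u\<close>, which
    can then be factored out.\<close>
  also have "\<dots> = join L (meet L ?u x) (meet L ?u z)"
    by (simp only: comm[of ?u] u assms z absorb)
  also have "\<dots> = meet L ?u (join L x z)"
    by (simp only: dist u assms z)
  finally show "join L x (meet L y z) = meet L ?u (join L x z)" .
qed


section \<open>Identities of sums\<close>

context dm_system
begin

lemma neg_neg: "i \<in> carrier S \<Longrightarrow> neg S (neg S i) = i"
  by (rule InvSL_neg_neg[OF index])

lemma index_neg: "i \<in> carrier S \<Longrightarrow> neg S i \<in> carrier S"
  by (rule alg_closed(4)[OF index_algebra])

lemma isl_le_join_iff: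
  assumes "i \<in> carrier S" "j \<in> carrier S"
  shows "isl_le S (join S i j) k \<longleftrightarrow> isl_le S i k \<and> isl_le S j k"
  using assms alg_closed(3)[OF index_algebra assms] unfolding isl_le_def
  by (metis InvSL_D(1-3)[OF index])

lemma isl_le_neg_iff:
  assumes "i \<in> carrier S" "j \<in> carrier S"
  shows "isl_le S (neg S i) j \<longleftrightarrow> isl_le S i (neg S j)"
  using assms unfolding isl_le_def by (metis InvSL_D(4)[OF index] neg_neg index_neg)

text \<open>Negation leaves \<open>F k\<close> unless \<open>k\<close> is its own negation; the
  second factor receives the negated values, so that negation becomes an operation.\<close>

definition double_fibre :: "'i \<Rightarrow> ('a \<times> 'a) alg" where
  "double_fibre k = \<lparr>carrier = carrier (F k) \<times> carrier (F (neg S k)),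
     meet = (\<lambda>x y. (meet (F k) (fst x) (fst y), meet (F (neg S k)) (snd x) (snd y))),
     join = (\<lambda>x y. (join (F k) (fst x) (fst y), join (F (neg S k)) (snd x) (snd y))),
     neg = (\<lambda>x. (n (neg S k) (snd x), n k (fst x)))\<rparr>"

lemma double_fibre_DML:
  assumes k: "k \<in> carrier S"
  shows "double_fibre k \<in> DML"
proof (rule DMLI, goal_cases)
  note k' = index_neg[OF k]
  have n: "n (neg S k) b \<in> carrier (F k)" if "b \<in> carrier (F (neg S k))" for b
    using neg_closed[OF k' that] by (simp add: neg_neg k)
  case 1
  show ?case
    using fibre_closed[OF k] fibre_closed[OF k'] n neg_closed[OF k]
    by (auto simp: double_fibre_def algebra_def lat_closed_def)
next
  case (2 x y z)
  note k' = index_neg[OF k]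
  note dl = distributive_latticeD[OF fibre[OF k]] distributive_latticeD[OF fibre[OF k']]
  obtain a a' b b' c c' where xyz: "x = (a, a')" "y = (b, b')" "z = (c, c')"
    and c: "a \<in> carrier (F k)" "b \<in> carrier (F k)" "c \<in> carrier (F k)"
      "a' \<in> carrier (F (neg S k))" "b' \<in> carrier (F (neg S k))" "c' \<in> carrier (F (neg S k))"
    using 2 by (auto simp: double_fibre_def)
  have inv: "n (neg S k) (n k a) = a" "n k (n (neg S k) a') = a'"
    using neg_inverse[OF k c(1)] neg_inverse[OF k' c(4)] by (simp_all add: neg_neg k)
  have dm: "n k (meet (F k) a b) = join (F (neg S k)) (n k a) (n k b)"
    "n k (join (F k) a b) = meet (F (neg S k)) (n k a) (n k b)"
    "n (neg S k) (meet (F (neg S k)) a' b') = join (F k) (n (neg S k) a') (n (neg S k) b')"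
    "n (neg S k) (join (F (neg S k)) a' b') = meet (F k) (n (neg S k) a') (n (neg S k) b')"
    using neg_meet[OF k c(1,2)] neg_join[OF k c(1,2)] neg_meet[OF k' c(4,5)] neg_join[OF k' c(4,5)]
    by (simp_all add: neg_neg k)
  show ?case
    unfolding xyz double_fibre_def
    by (simp only: alg.simps lat.simps fst_conv snd_conv prod.inject inv dm; intro conjI;
        (rule refl | rule dl; fact c))
qed

lemma sum_ops:
  assumes "i \<in> carrier S" "a \<in> carrier (F i)"
  shows "neg (dmp_sum S F p n) a = n i a"
    and "j \<in> carrier S \<Longrightarrow> b \<in> carrier (F j) \<Longrightarrow> k = join S i j \<Longrightarrow>
      meet (dmp_sum S F p n) a b = meet (F k) (p i k a) (p j k b)"
    and "j \<in> carrier S \<Longrightarrow> b \<in> carrier (F j) \<Longrightarrow> k = join S i j \<Longrightarrow>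
      join (dmp_sum S F p n) a b = join (F k) (p i k a) (p j k b)"
  using assms by (simp_all add: dmp_sum_def fibre_of_eq Let_def)

text \<open>\<open>I\<close> computes the fibre of a term's value, \<open>E\<close> the value
  itself, and \<open>W\<close> the value after transport into the double fibre at
  \<open>k\<close>.\<close>

lemma sum_satisfies:
  assumes S: "S \<Turnstile> e" and DML: "e \<in> Idt (DML :: ('a \<times> 'a) alg set)"
  shows "dmp_sum S F p n \<Turnstile> e"
  unfolding satisfies_def
proof (intro allI impI)
  let ?D = "dmp_sum S F p n"
  fix v :: "nat \<Rightarrow> 'a" assume v: "range v \<subseteq> carrier ?D"
  define ix where "ix u = fibre_of S F (v u)" for u
  have ix: "ix u \<in> carrier S" "v u \<in> carrier (F (ix u))" for u
  proof -
    have "v u \<in> carrier ?D" using v by auto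
    then obtain i where "i \<in> carrier S" "v u \<in> carrier (F i)" by (auto simp: dmp_sum_def)
    then show "ix u \<in> carrier S" "v u \<in> carrier (F (ix u))" by (simp_all add: ix_def fibre_of_eq)
  qed
  define I where "I t = eval S ix t" for t
  have I: "I t \<in> carrier S" for t
    unfolding I_def using ix by (intro eval_closed index_algebra) auto
  have I_simps: "I (Var u) = ix u" "I (s \<^bold>\<and> t) = join S (I s) (I t)" "I (s \<^bold>\<or> t) = join S (I s) (I t)"
    "I (\<^bold>\<not>t) = neg S (I t)" for s t u
    using I by (simp_all add: I_def InvSL_meet[OF index])
  have le: "isl_le S (I s) (join S (I s) (I t))" "isl_le S (I t) (join S (I s) (I t))" for s t
    by (rule isl_le_join[OF index I I])+
  define E where "E t = eval ?D v t" for t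
  have E: "E t \<in> carrier (F (I t))" for t
  proof (induction t)
    case (Conj s t)
    then show ?case
      using trans_closed[OF le(1)] trans_closed[OF le(2)] fibre_closed(2)[OF I[of "s \<^bold>\<and> t"]]
      by (simp add: E_def sum_ops(2)[OF I _ I _ refl] I_simps)
  next
    case (Disj s t)
    then show ?case
      using trans_closed[OF le(1)] trans_closed[OF le(2)] fibre_closed(3)[OF I[of "s \<^bold>\<or> t"]]
      by (simp add: E_def sum_ops(3)[OF I _ I _ refl] I_simps)
  qed (simp_all add: E_def I_simps ix sum_ops(1)[OF I] neg_closed I)
  have E_simps: "E (Var u) = v u"
    "E (s \<^bold>\<and> t) = meet (F (I (s \<^bold>\<and> t))) (p (I s) (I (s \<^bold>\<and> t)) (E s)) (p (I t) (I (s \<^bold>\<and> t)) (E t))"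
    "E (s \<^bold>\<or> t) = join (F (I (s \<^bold>\<or> t))) (p (I s) (I (s \<^bold>\<or> t)) (E s)) (p (I t) (I (s \<^bold>\<or> t)) (E t))"
    "E (\<^bold>\<not>t) = n (I t) (E t)" for s t u
    using sum_ops(1)[OF I E, of t] sum_ops(2,3)[OF I E I E refl, of s t]
    by (simp_all add: E_def I_simps)
  \<comment> \<open>Transitions are homomorphisms and compose, so a compound value can be
    transported operand by operand.\<close>
  have push: "p (I (s \<^bold>\<and> t)) k (E (s \<^bold>\<and> t)) = meet (F k) (p (I s) k (E s)) (p (I t) k (E t))"
    "p (I (s \<^bold>\<or> t)) k (E (s \<^bold>\<or> t)) = join (F k) (p (I s) k (E s)) (p (I t) k (E t))"
    if "isl_le S (join S (I s) (I t)) k" for s t k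
  proof -
    have "p (I s) (join S (I s) (I t)) (E s) \<in> carrier (F (join S (I s) (I t)))"
      "p (I t) (join S (I s) (I t)) (E t) \<in> carrier (F (join S (I s) (I t)))"
      using le E by (auto intro: trans_closed)
    then show "p (I (s \<^bold>\<and> t)) k (E (s \<^bold>\<and> t)) = meet (F k) (p (I s) k (E s)) (p (I t) k (E t))"
      "p (I (s \<^bold>\<or> t)) k (E (s \<^bold>\<or> t)) = join (F k) (p (I s) k (E s)) (p (I t) k (E t))"
      using trans_hom[OF that]
      by (simp_all add: E_simps I_simps lat_hom_def trans_comp[OF le(1) that E]
          trans_comp[OF le(2) that E])
  qed
  define k where "k = I (fst e)"
  have k: "k \<in> carrier S" by (simp add: k_def I)
  have "\<forall>i\<in>carrier S. \<exists>a. a \<in> carrier (F i)" using fibre_closed(1) by blast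
  \<comment> \<open>Arbitrary elements complete the assignment where \<open>v u\<close> has no image
    in the target fibre; the invariant \<open>W\<close> makes no claim about those
    components.\<close>
  then obtain c where c: "\<And>i. i \<in> carrier S \<Longrightarrow> c i \<in> carrier (F i)" by metis
  define w where "w u = (if isl_le S (ix u) k then p (ix u) k (v u) else c k,
     if isl_le S (ix u) (neg S k) then p (ix u) (neg S k) (v u) else c (neg S k))" for u
  have w: "range w \<subseteq> carrier (double_fibre k)"
    using k c ix by (auto simp: w_def double_fibre_def index_neg trans_closed)
  define W where "W t = eval (double_fibre k) w t" for t
  \<comment> \<open>Both components must be carried through the induction: negation swaps them, and
    it swaps the conditions below \<open>k\<close> and below \<open>neg S k\<close> as well.\<close>
  have W: "(isl_le S (I t) k \<longrightarrow> fst (W t) = p (I t) k (E t)) \<and>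
      (isl_le S (I t) (neg S k) \<longrightarrow> snd (W t) = p (I t) (neg S k) (E t))" for t
  proof (induction t)
    case (Var u)
    show ?case by (simp add: W_def w_def I_simps E_simps)
  next
    case (Conj s t)
    then show ?case
      using push(1)[of s t] isl_le_join_iff[OF I I, of s t]
      by (simp add: W_def double_fibre_def I_simps)
  next
    case (Disj s t)
    then show ?case
      using push(2)[of s t] isl_le_join_iff[OF I I, of s t]
      by (simp add: W_def double_fibre_def I_simps)
  next
    case (Neg t)
    then show ?case
      using neg_trans[OF _ E, of t k] neg_trans[OF _ E, of t "neg S k"]
        isl_le_neg_iff[OF I k, of t] isl_le_neg_iff[OF I index_neg[OF k], of t]
      by (simp add: W_def double_fibre_def I_simps E_simps neg_neg k)
  qed
  \<comment> \<open>Since \<open>e\<close> holds in \<open>S\<close>, both sides lie in the fibre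
    \<open>k\<close>, where the transition is the identity.\<close>
  have "I (snd e) = k"
    using S ix(1) unfolding satisfies_def k_def I_def by (metis image_subsetI)
  moreover have "isl_le S k k" using k by (simp add: isl_le_def InvSL_D(1)[OF index])
  moreover have "double_fibre k \<Turnstile> e" using DML double_fibre_DML[OF k] by (auto simp: Idt_def)
  then have "W (fst e) = W (snd e)" using w unfolding W_def satisfies_def by blast
  ultimately have "p k k (E (fst e)) = p k k (E (snd e))"
    using W[of "fst e"] W[of "snd e"] by (simp flip: k_def)
  then have "E (fst e) = E (snd e)"
    using trans_id[OF k] E[of "fst e"] E[of "snd e"] \<open>I (snd e) = k\<close> by (simp flip: k_def)
  then show "eval ?D v (fst e) = eval ?D v (snd e)" by (simp add: E_def)
qed

end

section \<open>The remaining inclusions of the cycle\<close>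

lemma Idt_DM4_subset: "Idt {DM4} \<subseteq> Idt (DML :: 'a alg set)"
proof
  fix e assume "e \<in> Idt {DM4}"
  then have "A \<Turnstile> e" if "A \<in> DML" for A :: "'a alg"
    using de_morgan_lattice.satisfies_if_DM4[OF de_morgan_lattice.intro[OF that]] by (simp add: Idt_def)
  then show "e \<in> Idt (DML :: 'a alg set)" unfolding Idt_def by blast
qed

text \<open>\<open>IS2\<close> and \<open>IS3\<close> account for \<open>e\<close> in the index, and
  \<open>DM4\<close> for \<open>e\<close> in all De Morgan lattices on
  \<open>'a \<times> 'a\<close>, the type of the double fibres.\<close>

lemma dmp_sums_subset_generated_variety:
  "(dmp_sums (generated_variety {IS2, IS3}) :: 'a alg set) \<subseteq> generated_variety {DM4, IS2, IS3}"
proof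
  fix A :: "'a alg" assume "A \<in> dmp_sums (generated_variety {IS2, IS3})"
  then obtain S :: "'a alg" and F :: "'a \<Rightarrow> 'a lat" and p n
    where A: "algebra A" "A \<cong> dmp_sum S F p n" and sys: "dm_system S F p n"
      and S: "S \<in> generated_variety {IS2, IS3}"
    by (auto simp: dmp_sums_def)
  have "A \<Turnstile> e" if e: "e \<in> Idt {DM4, IS2, IS3}" for e
  proof -
    have "S \<in> Mod (Idt {IS2, IS3})"
      using S algebra_DM4_IS2_IS3 by (simp add: generated_variety_eq)
    moreover have "e \<in> Idt {IS2, IS3}" using e by (simp add: Idt_def)
    ultimately have "S \<Turnstile> e" unfolding Mod_def by blast
    moreover have "e \<in> Idt (DML :: ('a \<times> 'a) alg set)"
      using e by (intro subsetD[OF Idt_DM4_subset]) (simp add: Idt_def)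
    ultimately have "dmp_sum S F p n \<Turnstile> e" by (rule dm_system.sum_satisfies[OF sys])
    moreover obtain h where "alg_hom h A (dmp_sum S F p n)" "inj_on h (carrier A)"
      using A(2) by (auto simp: isomorphic_def bij_betw_def)
    ultimately show ?thesis using satisfies_embedding[OF A(1)] by blast
  qed
  then show "A \<in> generated_variety {DM4, IS2, IS3}"
    using A(1) algebra_DM4_IS2_IS3 by (simp add: generated_variety_eq Mod_def)
qed

lemma generated_variety_subset_RBip:
  "(generated_variety {DM4, IS2, IS3} :: 'a alg set) \<subseteq> RBip (DML :: nat alg set)"
proof
  fix A :: "'a alg" assume "A \<in> generated_variety {DM4, IS2, IS3}"
  then have A: "algebra A" "\<And>e. e \<in> Idt {DM4, IS2, IS3} \<Longrightarrow> A \<Turnstile> e"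
    using algebra_DM4_IS2_IS3 by (simp_all add: generated_variety_eq Mod_def)
  have "A \<Turnstile> e" if e: "e \<in> Idt (DML :: nat alg set)" "regular_bipolarly_balanced e" for e
  proof (rule A(2))
    \<comment> \<open>The identities are given on \<open>nat\<close>, while \<open>DM4\<close> lives
      on \<open>elt\<close>.\<close>
    have "e \<in> Idt (DML :: elt alg set)" using e(1) unfolding DML_def by (rule Idt_Mod_nat)
    then show "e \<in> Idt {DM4, IS2, IS3}"
      using DM4_in_DML IS_satisfies_rbb[OF e(2)] by (simp add: Idt_def)
  qed
  then show "A \<in> RBip (DML :: nat alg set)" using A(1) unfolding RBip_def Mod_def by blast
qed

text \<open>All axioms of De Morgan bisemilattices are balanced regular. The bipolar axiom changes
  the polarity of \<open>y\<close>, but \<open>x\<close> has both polarities on each side, so it is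
  bipolar and regular.\<close>

lemma RBip_subset_RBDMBL: "(RBip (DML :: nat alg set) :: 'a alg set) \<subseteq> RBDMBL"
proof -
  have "dmbl_axioms \<union> {bipolar_axiom} \<subseteq> Idt (DML :: nat alg set)"
    using de_morgan_lattice.satisfies_bipolar_axiom[OF de_morgan_lattice.intro]
    by (auto simp: Idt_def) (simp add: DML_def Mod_def)
  moreover have "regular_bipolarly_balanced e" if "e \<in> dmbl_axioms \<union> {bipolar_axiom}" for e
    using that unfolding dmbl_axioms_def
    by (elim UnE insertE emptyE; hypsubst) (auto simp: rbb_iff all_bool_eq)
  ultimately have "dmbl_axioms \<union> {bipolar_axiom} \<subseteq>
      {e \<in> Idt (DML :: nat alg set). regular_bipolarly_balanced e}"
    by blast
  moreover have "RBDMBL = Mod (dmbl_axioms \<union> {bipolar_axiom})"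
    unfolding RBDMBL_def DMBL_def Mod_def by blast
  ultimately show ?thesis unfolding RBip_def Mod_def by blast
qed

theorem theorem4p4:
  shows "(RBDMBL :: 'a alg set) = RBip (DML :: nat alg set) \<and>
         (RBDMBL :: 'a alg set) = generated_variety {DM4, IS2, IS3} \<and>
         (RBDMBL :: 'a alg set) = dmp_sums (generated_variety {IS2, IS3})"
proof (intro conjI)
  note subs = RBDMBL_subset_dmp_sums[where 'a = 'a] dmp_sums_subset_generated_variety[where 'a = 'a]
    generated_variety_subset_RBip[where 'a = 'a] RBip_subset_RBDMBL[where 'a = 'a]
  show "(RBDMBL :: 'a alg set) = RBip (DML :: nat alg set)"
    by (rule antisym[OF order_trans[OF order_trans[OF subs(1,2)] subs(3)] subs(4)])
  show "(RBDMBL :: 'a alg set) = generated_variety {DM4, IS2, IS3}"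
    by (rule antisym[OF order_trans[OF subs(1,2)] order_trans[OF subs(3,4)]])
  show "(RBDMBL :: 'a alg set) = dmp_sums (generated_variety {IS2, IS3})"
    by (rule antisym[OF subs(1) order_trans[OF subs(2) order_trans[OF subs(3,4)]]])
qed

end
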